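(* Assume that the system $\Sigma$, its extension $\Sigma^e$ and the function $V$ satisfy the standing assumptions and hypotheses (i)--(iv) of the context, and let $R,\eta>0$. Let the constant $M=M(R,\eta)>0$ in the definition of $U^e(x)$ be selected such that a solution to the satisficing problem SP (defined in the context) exists for any $x\in B(0,R)$ and any $T>0$ when the number $s$ of switches is allowed to be large enough. Let $T_{max}>0$ be such that for all $T\in[0,T_{max}]$ and all $x\in B(0,R)$ one has $V(z)-V(x)\le-\frac{\eta}{2}\|x\|^2T$ for all $z\in\mathcal{R}_{\mathcal{G}}(T,x,U^e(x))$, and let $T\in[0,T_{max}]$, $T>0$. Suppose there exists a constant $C>0$ such that the solutions to SP are bounded as follows: $$\|\bar u(x(t_0+nT),\tau)\|\le C\|x(t_0+nT)\|\quad\text{for all }\tau\in[0,T],\ n\in\mathbb{N}\cup\{0\},$$ where $x(t_0+nT)$ is the state of the closed-loop system at time $t_0+nT$. Then the concatenated control $u^c$ defined in the context renders the closed-loop system $\Sigma$ uniformly asymptotically stable.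
   Context: The system is $\Sigma:\ \dot x=f_0(x)+\sum_{i=1}^m f_i(x)u_i=:f^u(x)$, with state $x\in\mathbb{R}^n$, controls $u=[u_1,\ldots,u_m]$, $u_i\in\mathbb{R}$, $m<n$. $\mathcal{F}=\{f_0,\ldots,f_m\}$, $L(\mathcal{F})$ is the Lie algebra of vector fields generated by $\mathcal{F}$, and $L_x(\mathcal{F})=\{f(x): f\in L(\mathcal{F})\}$. $\mathcal{P}^m$ is the family of piecewise constant, right-continuous, $\mathbb{R}^m$-valued control functions, and $x^o(t,x,u)$ is the solution of $\Sigma$ starting at $x$ at time $0$ under control $u$. $B(0,R)$ is the open ball of radius $R$ about the origin; $R$ is taken sufficiently large to accommodate all initial conditions of interest. Hypotheses. (i) The vector fields $f_0,\ldots,f_m$ are real, analytic, complete and linearly independent, $f_0(0)=0$, and they generate a nilpotent Lie algebra $L(\mathcal{F})$ of dimension $r\ge n+1$. (ii) $\Sigma$ is strongly controllable: for any $T>0$ and any $x_0,x_f\in\mathbb{R}^n$ there exist $u\in\mathcal{P}^m$ and a time $t\le T$ with $x^o(t,x_0,u)=x_f$. (iii) $V:\mathbb{R}^n\to\mathbb{R}_+$ is twice continuously differentiable, $V(0)=0$, and there is $\zeta>0$ with $\|\nabla V(x)\|\ge\zeta\|x\|$ for all $x\in\mathbb{R}^n$. (iv) There are continuous, strictly increasing functions $\alpha,\beta:\mathbb{R}_+\to\mathbb{R}_+$ with $\alpha(0)=\beta(0)=0$ and $\alpha(\|x\|)\le V(x)\le\beta(\|x\|)$ for all $x\in\mathbb{R}^n$.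 Extended system: $\Sigma^e:\ \dot x=g_0(x)+\sum_{i=1}^{r-1}g_i(x)v_i=:g^v(x)$, $v=[v_1,\ldots,v_{r-1}]$, where $\mathcal{G}=\{g_0,\ldots,g_{r-1}\}$ is a basis of $L(\mathcal{F})$, $g_i=f_i$ for $0\le i\le m$, the remaining $g_i$ are Lie brackets of the $f_i$, and $\{g_1(x),\ldots,g_{r-1}(x)\}$ contains a basis of $L_x(\mathcal{F})$ (which equals $\mathbb{R}^n$) for every $x\in B(0,R)$. $x^e(t,x,v)$ is the solution of $\Sigma^e$ starting at $x$ at time $0$ under the constant control $v$. For constants $R,M,\eta>0$ and $x\in B(0,R)$, with $\nabla V$ a row vector, $$U^e(x)=\{v\in\mathbb{R}^{r-1}:\ \nabla V(x)\,g^v(x)<-\eta\|x\|^2,\ \|v\|\le M\|x\|\},$$ $$\mathcal{R}_{\mathcal{G}}(T,x,U^e(x))=\{x^e(T,x,v):\ v\in U^e(x)\}.$$ Lie group formulation. $H$ is the (Palais) analytic, simply connected, nilpotent Lie group, whose underlying group is a group of diffeomorphisms of $\mathbb{R}^n$, with a global analytic action $(h,p)\mapsto h(p)$ on $\mathbb{R}^n$ inducing an isomorphism $\phi_L^+:L(H)\to L(\mathcal{F})$, where $L(H)$ is the Lie algebra of right-invariant vector fields on $H$, via $\phi_L^+(\lambda)(p)=(d\phi_p)_e(\lambda(e))$, $\phi_p(h)=h(p)$. Let $\mu_i\in L(H)$ satisfy $\phi_L^+(\mu_i)=g_i$, $i=0,\ldots,r-1$. On $H$ consider $\Sigma_H:\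 \dot S=\{\mu_0+\sum_{i=1}^m u_i\mu_i\}S$, $S(0)=e$, and $\Sigma_H^e:\ \dot S^e=\{\mu_0+\sum_{i=1}^{r-1}v_i\mu_i\}S^e$, $S^e(0)=e$, where $\mu S$ is the image of $\mu\in T_eH$ under the differential of right translation by $S$. Let $\{\psi_0,\ldots,\psi_{r-1}\}$ be a basis of $L(H)$ with $\psi_i=\mu_i$ for $i=0,\ldots,m$, such that $(t_0,\ldots,t_{r-1})\mapsto\exp(t_0\psi_0)\circ\cdots\circ\exp(t_{r-1}\psi_{r-1})$ is a global coordinate chart $\mathbb{R}^r\to H$. The $\gamma$-coordinates $\gamma(t)=[\gamma_0,\ldots,\gamma_{r-1}](t)$ and $\gamma^e(t)$ of $S(t)$ and $S^e(t)$ are defined by $S(t)=\prod_{i=0}^{r-1}\exp(\gamma_i(t)\psi_i)$ and $S^e(t)=\prod_{i=0}^{r-1}\exp(\gamma^e_i(t)\psi_i)$. For $u\in\mathcal{P}^m$ and constant $v\in\mathbb{R}^{r-1}$, put $u^d=[1\ u\ 0\ \cdots\ 0]$ and $v^d=[1\ v]$ in $\mathbb{R}^r$; $\gamma(T,u^d)$ and $\gamma^e(T,v^d)$ denote the $\gamma$-coordinates at time $T$ resulting from these controls. Define $$\mathcal{R}_\gamma(T,U^e(x))=\{\gamma^e(T,v^d):\ v\in U^e(x)\}.$$ Satisficing problem SP: for given constants $\eta>0$, $T>0$, $M>0$, and for $x\in B(0,R)$, find parameter vectors $u_{(k)}\in\mathbb{R}^m$, $k=1,\ldots,s$ ($s\in\mathbb{N}$),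 such that $\gamma(T,\bar u^d)\in\mathcal{R}_\gamma(T,U^e(x))$, where $\bar u\in\mathcal{P}^m$ is given by $\bar u(\tau)=u_{(k)}$ for $\tau\in[t_k,t_k+\varepsilon)$, with $\varepsilon s=T$, $t_1=0$, and $t_k=t_{k-1}+\varepsilon$ for $k\ge2$. The control so generated is written $\bar u(x,\tau)$, $\tau\in[0,T]$. Concatenated control. For initial time $t_0\geq 0$, the feedback $u^c$ is the concatenation of solutions of SP computed at the discrete instants $t_0+nT$, $n\in\mathbb{N}\cup\{0\}$: on the interval $[t_0+nT,t_0+(n+1)T]$ the control applied to $\Sigma$ at time $t_0+nT+\tau$ is $\bar u(x(t_0+nT),\tau)$, $\tau\in[0,T]$, where $x(t_0+nT)$ is the state of the closed-loop system at time $t_0+nT$. Uniform asymptotic stability (of the origin) means: (1) uniform stability: for every $\rho>0$ there is $\delta(\rho)>0$, independent of $t_0$, such that $\|x(t_0)\|<\delta(\rho)$ implies $\|x(t)\|<\rho$ for all $t\ge t_0$; and (2) convergence to the origin uniformly with respect to time: for initial states $x_0=x(t_0)$ in a neighbourhood of the origin and every $\rho>0$ there is $\bar T(\rho,x_0)\ge0$, independent of $t_0$, such that $\|x(t)\|<\rho$ for all $t\ge t_0+\bar T$.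
   Formalization: Solvability of SP is required only for nonzero x in B(0,R), since U^e(0) is empty and SP has no solution at x=0 as literally stated; at x=0 the bound with C forces the control to be zero. The bound with C is required only at closed-loop states in B(0,R). *)

theory Defs
  imports "HOL-Analysis.Analysis" "HOL-Library.Function_Algebras" "HOL-Algebra.Generated_Groups"
begin

(* Vector fields on a Euclidean space form a real vector space under the pointwise operations,
   so that the library notions span, independent, subspace and dim apply to them. *)

instantiation "fun" :: (type, real_vector) real_vector
begin

definition scaleR_fun :: "real \<Rightarrow> ('a \<Rightarrow> 'b) \<Rightarrow> 'a \<Rightarrow> 'b"
  where "scaleR_fun c f = (\<lambda>x. c *\<^sub>R f x)"

instance
  by standard (auto simp: scaleR_fun_def plus_fun_def scaleR_add_right scaleR_add_left)

end

(* Linear independence and bases of indexed families: injectivity rules out repetitions. *)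

definition independent_family :: "('i \<Rightarrow> 'v::real_vector) \<Rightarrow> bool"
  where "independent_family b \<longleftrightarrow> inj b \<and> independent (range b)"

definition family_basis :: "('i \<Rightarrow> 'v::real_vector) \<Rightarrow> 'v set \<Rightarrow> bool"
  where "family_basis b L \<longleftrightarrow> independent_family b \<and> span (range b) = L"


section \<open>Analytic maps and vector fields\<close>

(* Local expansion into a multivariate power series; the coefficients are indexed by
   multi-indices, i.e. extensional functions from Basis to the natural numbers. *)

definition real_analytic :: "('a::euclidean_space \<Rightarrow> 'b::euclidean_space) \<Rightarrow> bool"
  where "real_analytic f \<longleftrightarrow>
    (\<forall>x. \<exists>\<rho>>0. \<exists>c. \<forall>y\<in>ball x \<rho>.
      ((\<lambda>a. (\<Prod>b\<in>Basis. ((y - x) \<bullet> b) ^ a b) *\<^sub>R c a) has_sum f y)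
        (Basis \<rightarrow>\<^sub>E (UNIV :: nat set)))"

definition integral_curve :: "('a::real_normed_vector \<Rightarrow> 'a) \<Rightarrow> (real \<Rightarrow> 'a) \<Rightarrow> bool"
  where "integral_curve X c \<longleftrightarrow> (\<forall>t. (c has_vector_derivative X (c t)) (at t))"

definition complete_field :: "('a::real_normed_vector \<Rightarrow> 'a) \<Rightarrow> bool"
  where "complete_field X \<longleftrightarrow> (\<forall>p. \<exists>c. c 0 = p \<and> integral_curve X c)"

definition bracket :: "('a::real_normed_vector \<Rightarrow> 'a) \<Rightarrow> ('a \<Rightarrow> 'a) \<Rightarrow> 'a \<Rightarrow> 'a"
  where "bracket X Y = (\<lambda>x. frechet_derivative Y (at x) (X x) - frechet_derivative X (at x) (Y x))"

definition is_lie_algebra :: "('a::real_normed_vector \<Rightarrow> 'a) set \<Rightarrow> bool"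
  where "is_lie_algebra L \<longleftrightarrow> subspace L \<and> (\<forall>X\<in>L. \<forall>Y\<in>L. bracket X Y \<in> L)"

definition lie_generated :: "('a::real_normed_vector \<Rightarrow> 'a) set \<Rightarrow> ('a \<Rightarrow> 'a) set"
  where "lie_generated F = is_lie_algebra hull F"

definition lie_eval :: "('a::real_normed_vector \<Rightarrow> 'a) set \<Rightarrow> 'a \<Rightarrow> 'a set"
  where "lie_eval F x = {X x | X. X \<in> lie_generated F}"

primrec lie_lower_central :: "('a::real_normed_vector \<Rightarrow> 'a) set \<Rightarrow> nat \<Rightarrow> ('a \<Rightarrow> 'a) set"
  where
    "lie_lower_central L 0 = L"
  | "lie_lower_central L (Suc k) = span {bracket X Y | X Y. X \<in> L \<and> Y \<in> lie_lower_central L k}"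

definition nilpotent_lie_algebra :: "('a::real_normed_vector \<Rightarrow> 'a) set \<Rightarrow> bool"
  where "nilpotent_lie_algebra L \<longleftrightarrow> is_lie_algebra L \<and> (\<exists>k. lie_lower_central L k = {0})"

inductive_set iterated_brackets :: "('a::real_normed_vector \<Rightarrow> 'a) set \<Rightarrow> ('a \<Rightarrow> 'a) set"
  for F :: "('a::real_normed_vector \<Rightarrow> 'a) set"
  where
    base: "X \<in> F \<Longrightarrow> Y \<in> F \<Longrightarrow> bracket X Y \<in> iterated_brackets F"
  | left: "X \<in> F \<Longrightarrow> Y \<in> iterated_brackets F \<Longrightarrow> bracket X Y \<in> iterated_brackets F"
  | right: "X \<in> iterated_brackets F \<Longrightarrow> Y \<in> F \<Longrightarrow> bracket X Y \<in> iterated_brackets F"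
  | both: "X \<in> iterated_brackets F \<Longrightarrow> Y \<in> iterated_brackets F \<Longrightarrow> bracket X Y \<in> iterated_brackets F"

definition lie_isomorphism ::
    "(('a::real_normed_vector \<Rightarrow> 'a) \<Rightarrow> ('b::real_normed_vector \<Rightarrow> 'b)) \<Rightarrow> ('a \<Rightarrow> 'a) set \<Rightarrow> ('b \<Rightarrow> 'b) set \<Rightarrow> bool"
  where "lie_isomorphism \<phi> L L' \<longleftrightarrow> bij_betw \<phi> L L' \<and>
    (\<forall>X\<in>L. \<forall>Y\<in>L. \<phi> (X + Y) = \<phi> X + \<phi> Y) \<and>
    (\<forall>c. \<forall>X\<in>L. \<phi> (c *\<^sub>R X) = c *\<^sub>R \<phi> X) \<and>
    (\<forall>X\<in>L. \<forall>Y\<in>L. \<phi> (bracket X Y) = bracket (\<phi> X) (\<phi> Y))"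


section \<open>Control systems\<close>

(* A control-affine system is a family indexed by an option type: None is the drift and Some i
   the control field of the i-th input. *)

definition affine_field :: "('i::finite option \<Rightarrow> 'a::real_vector \<Rightarrow> 'a) \<Rightarrow> real ^ 'i \<Rightarrow> 'a \<Rightarrow> 'a"
  where "affine_field f u x = f None x + (\<Sum>i\<in>UNIV. (u $ i) *\<^sub>R f (Some i) x)"

(* Solution on [a,b] of the ODE with right-hand side F t (x t): continuous, and differentiable
   with the prescribed derivative at all but finitely many instants (the switching times). *)

definition pw_solution ::
    "(real \<Rightarrow> 'a::real_normed_vector \<Rightarrow> 'a) \<Rightarrow> (real \<Rightarrow> 'a) \<Rightarrow> real \<Rightarrow> real \<Rightarrow> bool"
  where "pw_solution F x a b \<longleftrightarrow> continuous_on {a..b} x \<and>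
    (\<exists>D. finite D \<and>
      (\<forall>t\<in>{a..b} - D. (x has_vector_derivative F t (x t)) (at t within {a..b})))"

(* Piecewise constant and right-continuous on [0,oo): on each bounded interval the control can
   change its value only at the points of a finite set D, which belong to the piece on their
   right. *)

definition pc_control :: "(real \<Rightarrow> 'a) \<Rightarrow> bool"
  where "pc_control u \<longleftrightarrow> (\<forall>b>0. \<exists>D. finite D \<and>
    (\<forall>\<sigma> \<tau>. 0 \<le> \<sigma> \<and> \<sigma> \<le> \<tau> \<and> \<tau> < b \<and> {\<sigma><..\<tau>} \<inter> D = {} \<longrightarrow> u \<sigma> = u \<tau>))"

definition strongly_controllable ::
    "('m::finite option \<Rightarrow> real ^ 'n \<Rightarrow> real ^ 'n) \<Rightarrow> bool"
  where "strongly_controllable f \<longleftrightarrow>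
    (\<forall>T>0. \<forall>x0 xf. \<exists>u t \<xi>. pc_control u \<and> 0 \<le> t \<and> t \<le> T \<and>
      pw_solution (\<lambda>\<tau>. affine_field f (u \<tau>)) \<xi> 0 t \<and> \<xi> 0 = x0 \<and> \<xi> t = xf)"


section \<open>The function V and the decrease condition\<close>

definition gradient :: "('a::real_inner \<Rightarrow> real) \<Rightarrow> 'a \<Rightarrow> 'a"
  where "gradient V x = (THE D. GDERIV V x :> D)"

definition twice_continuously_differentiable :: "('a::real_inner \<Rightarrow> real) \<Rightarrow> bool"
  where "twice_continuously_differentiable V \<longleftrightarrow>
    (\<exists>G. \<exists>H :: 'a \<Rightarrow> 'a \<Rightarrow>\<^sub>L 'a.
      (\<forall>x. GDERIV V x :> G x) \<and>
      (\<forall>x. (G has_derivative blinfun_apply (H x)) (at x)) \<and>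
      continuous_on UNIV H)"

definition class_K :: "(real \<Rightarrow> real) \<Rightarrow> bool"
  where "class_K a \<longleftrightarrow> continuous_on {0..} a \<and> strict_mono_on {0..} a \<and> a 0 = 0"

definition U_ext ::
    "('i::finite option \<Rightarrow> real ^ 'n \<Rightarrow> real ^ 'n) \<Rightarrow> (real ^ 'n \<Rightarrow> real) \<Rightarrow> real \<Rightarrow> real \<Rightarrow> real ^ 'n \<Rightarrow> (real ^ 'i) set"
  where "U_ext g V \<eta> M x =
    {v. gradient V x \<bullet> affine_field g v x < - \<eta> * (norm x)\<^sup>2 \<and> norm v \<le> M * norm x}"

definition reach_ext ::
    "('i::finite option \<Rightarrow> real ^ 'n \<Rightarrow> real ^ 'n) \<Rightarrow> real \<Rightarrow> real ^ 'n \<Rightarrow> (real ^ 'i) set \<Rightarrow> (real ^ 'n) set"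
  where "reach_ext g T x U =
    {\<xi> T | \<xi> v. v \<in> U \<and> \<xi> 0 = x \<and> pw_solution (\<lambda>_. affine_field g v) \<xi> 0 T}"


section \<open>The Lie group\<close>

(* H is a group of transformations of R^n that possesses a global chart, so its analytic structure
   is determined by the inverse K of one such chart, a parametrization of H by R^r.  Points,
   tangent vectors and vector fields on H are written in this chart.  In particular H is
   connected and simply connected.  The parametrization by products of exponentials need not be K
   itself: see global_chart below. *)

definition transformation_group :: "('x \<Rightarrow> 'x) set \<Rightarrow> ('x \<Rightarrow> 'x) monoid"
  where "transformation_group H = \<lparr>carrier = H, monoid.mult = (\<circ>), one = id\<rparr>"

primrec group_lower_central :: "('g, 'z) monoid_scheme \<Rightarrow> nat \<Rightarrow> 'g set"
  where
    "group_lower_central G 0 = carrier G"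
  | "group_lower_central G (Suc k) = generate G
      {a \<otimes>\<^bsub>G\<^esub> b \<otimes>\<^bsub>G\<^esub> m_inv G a \<otimes>\<^bsub>G\<^esub> m_inv G b | a b.
        a \<in> carrier G \<and> b \<in> group_lower_central G k}"

definition nilpotent_group :: "('g, 'z) monoid_scheme \<Rightarrow> bool"
  where "nilpotent_group G \<longleftrightarrow> group G \<and> (\<exists>k. group_lower_central G k = {\<one>\<^bsub>G\<^esub>})"

definition coord :: "('p \<Rightarrow> 'h) \<Rightarrow> 'h \<Rightarrow> 'p"
  where "coord K = inv_into UNIV K"

definition chart_mult :: "('p \<Rightarrow> 'x \<Rightarrow> 'x) \<Rightarrow> 'p \<Rightarrow> 'p \<Rightarrow> 'p"
  where "chart_mult K y z = coord K (K y \<circ> K z)"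

definition chart_unit :: "('p \<Rightarrow> 'x \<Rightarrow> 'x) \<Rightarrow> 'p"
  where "chart_unit K = coord K id"

definition analytic_transformation_group ::
    "(real ^ 'n \<Rightarrow> real ^ 'n) set \<Rightarrow> (real ^ 'r \<Rightarrow> real ^ 'n \<Rightarrow> real ^ 'n) \<Rightarrow> bool"
  where "analytic_transformation_group H K \<longleftrightarrow>
    group (transformation_group H) \<and> bij_betw K UNIV H \<and>
    real_analytic (\<lambda>(y, z). chart_mult K y z) \<and>
    real_analytic (\<lambda>y. coord K (m_inv (transformation_group H) (K y))) \<and>
    real_analytic (\<lambda>(y, p). K y p)"

definition right_invariant_fields ::
    "(real ^ 'r \<Rightarrow> 'x \<Rightarrow> 'x) \<Rightarrow> (real ^ 'r \<Rightarrow> real ^ 'r) set"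
  where "right_invariant_fields K = {X. real_analytic X \<and>
    (\<forall>y z. frechet_derivative (\<lambda>y. chart_mult K y z) (at y) (X y) = X (chart_mult K y z))}"

(* The differential of right translation by K y, applied to a tangent vector at the identity. *)

definition right_translate ::
    "(real ^ 'r \<Rightarrow> 'x \<Rightarrow> 'x) \<Rightarrow> real ^ 'r \<Rightarrow> real ^ 'r \<Rightarrow> real ^ 'r"
  where "right_translate K X y = frechet_derivative (\<lambda>z. chart_mult K z y) (at (chart_unit K)) X"

definition action_field ::
    "(real ^ 'r \<Rightarrow> real ^ 'n \<Rightarrow> real ^ 'n) \<Rightarrow> (real ^ 'r \<Rightarrow> real ^ 'r) \<Rightarrow> real ^ 'n \<Rightarrow> real ^ 'n"
  where "action_field K X p =
    frechet_derivative (\<lambda>y. K y p) (at (chart_unit K)) (X (chart_unit K))"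

definition lie_exp :: "(real ^ 'r \<Rightarrow> 'x \<Rightarrow> 'x) \<Rightarrow> (real ^ 'r \<Rightarrow> real ^ 'r) \<Rightarrow> 'x \<Rightarrow> 'x"
  where "lie_exp K X = K ((SOME c. c 0 = chart_unit K \<and> integral_curve X c) 1)"

(* The index set {0,...,r-1} of the bases is ('m + 'k) option in this order, where None stands
   for 0, 'm for 1,...,m, and 'k for m+1,...,r-1. *)

definition basis_indices :: "('m::{finite,linorder} + 'k::{finite,linorder}) option list"
  where "basis_indices =
    None # map (Some \<circ> Inl) (sorted_list_of_set UNIV) @ map (Some \<circ> Inr) (sorted_list_of_set UNIV)"

definition exp_product ::
    "(real ^ ('m::{finite,linorder} + 'k::{finite,linorder}) option \<Rightarrow> 'x \<Rightarrow> 'x) \<Rightarrow>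
     (('m + 'k) option \<Rightarrow> real ^ ('m + 'k) option \<Rightarrow> real ^ ('m + 'k) option) \<Rightarrow>
     real ^ ('m + 'k) option \<Rightarrow> 'x \<Rightarrow> 'x"
  where "exp_product K \<psi> t = foldr (\<circ>) (map (\<lambda>i. lie_exp K ((t $ i) *\<^sub>R \<psi> i)) basis_indices) id"

definition global_chart ::
    "(real ^ 'n \<Rightarrow> real ^ 'n) set \<Rightarrow> (real ^ 'r \<Rightarrow> real ^ 'n \<Rightarrow> real ^ 'n) \<Rightarrow>
     (real ^ 'r \<Rightarrow> real ^ 'n \<Rightarrow> real ^ 'n) \<Rightarrow> bool"
  where "global_chart H K E \<longleftrightarrow> bij_betw E UNIV H \<and>
    real_analytic (\<lambda>t. coord K (E t)) \<and> real_analytic (\<lambda>y. coord E (K y))"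

(* S solves dS/dt = (sum_i w_i mu_i) S, S 0 = e, on [0,T], with values in H. *)

definition group_solution ::
    "(real ^ 'r \<Rightarrow> 'x \<Rightarrow> 'x) \<Rightarrow> ('r::finite \<Rightarrow> real ^ 'r \<Rightarrow> real ^ 'r) \<Rightarrow> (real \<Rightarrow> real ^ 'r) \<Rightarrow>
     (real \<Rightarrow> 'x \<Rightarrow> 'x) \<Rightarrow> real \<Rightarrow> bool"
  where "group_solution K \<mu> w S T \<longleftrightarrow> S 0 = id \<and> (\<forall>t\<in>{0..T}. S t \<in> range K) \<and>
    pw_solution (\<lambda>t y. right_translate K (\<Sum>i\<in>UNIV. (w t $ i) *\<^sub>R \<mu> i (chart_unit K)) y)
      (\<lambda>t. coord K (S t)) 0 T"

(* G is the vector of gamma-coordinates at time T resulting from the control w. *)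

definition gamma_at ::
    "(real ^ ('m::{finite,linorder} + 'k::{finite,linorder}) option \<Rightarrow> 'x \<Rightarrow> 'x) \<Rightarrow>
     (('m + 'k) option \<Rightarrow> real ^ ('m + 'k) option \<Rightarrow> real ^ ('m + 'k) option) \<Rightarrow>
     (('m + 'k) option \<Rightarrow> real ^ ('m + 'k) option \<Rightarrow> real ^ ('m + 'k) option) \<Rightarrow>
     real \<Rightarrow> (real \<Rightarrow> real ^ ('m + 'k) option) \<Rightarrow> real ^ ('m + 'k) option \<Rightarrow> bool"
  where "gamma_at K \<mu> \<psi> T w G \<longleftrightarrow>
    (\<exists>S. group_solution K \<mu> w S T \<and> S T = exp_product K \<psi> G)"

definition embed_u :: "real ^ 'm \<Rightarrow> real ^ ('m::finite + 'k::finite) option"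
  where "embed_u u = (\<chi> i. case i of None \<Rightarrow> 1 | Some (Inl j) \<Rightarrow> u $ j | Some (Inr _) \<Rightarrow> 0)"

definition embed_v :: "real ^ 'i::finite \<Rightarrow> real ^ 'i option"
  where "embed_v v = (\<chi> i. case i of None \<Rightarrow> 1 | Some j \<Rightarrow> v $ j)"

definition reach_gamma ::
    "(real ^ ('m::{finite,linorder} + 'k::{finite,linorder}) option \<Rightarrow> 'x \<Rightarrow> 'x) \<Rightarrow>
     (('m + 'k) option \<Rightarrow> real ^ ('m + 'k) option \<Rightarrow> real ^ ('m + 'k) option) \<Rightarrow>
     (('m + 'k) option \<Rightarrow> real ^ ('m + 'k) option \<Rightarrow> real ^ ('m + 'k) option) \<Rightarrow>
     real \<Rightarrow> (real ^ ('m + 'k)) set \<Rightarrow> (real ^ ('m + 'k) option) set"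
  where "reach_gamma K \<mu> \<psi> T U = {G. \<exists>v\<in>U. gamma_at K \<mu> \<psi> T (\<lambda>_. embed_v v) G}"


section \<open>The satisficing problem and the closed loop\<close>

(* The control with value w k on [(k - 1) * T / s, k * T / s) for k = 1,...,s.  The last value
   is kept from T on. *)

definition step_control :: "real \<Rightarrow> nat \<Rightarrow> (nat \<Rightarrow> 'a) \<Rightarrow> real \<Rightarrow> 'a"
  where "step_control T s w \<tau> = w (min s (nat \<lfloor>\<tau> / (T / real s)\<rfloor> + 1))"

lemma step_control_eq:
  assumes "T > 0" "1 \<le> k" "k \<le> s" "(real k - 1) * (T / s) \<le> \<tau>" "\<tau> < real k * (T / s)"
  shows "step_control T s w \<tau> = w k"
proof -
  have e: "T / s > 0" using assms by simp
  have "real k - 1 \<le> \<tau> / (T / s)" using assms(4) e by (subst pos_le_divide_eq) auto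
  moreover have "\<tau> / (T / s) < real k" using assms(5) e by (subst pos_divide_less_eq) auto
  ultimately have "\<lfloor>\<tau> / (T / s)\<rfloor> = int k - 1" by (subst floor_eq_iff) auto
  then have "nat \<lfloor>\<tau> / (T / s)\<rfloor> + 1 = k" using assms(2) by simp
  then show ?thesis using assms(3) by (simp add: step_control_def)
qed

lemma pc_control_step_control:
  assumes "T > 0" "s \<ge> 1"
  shows "pc_control (step_control T s w)"
  unfolding pc_control_def
proof (intro allI impI exI conjI)
  define e where "e = T / s"
  have e: "e > 0" using assms by (simp add: e_def)
  show "finite ((\<lambda>k. real k * e) ` {0..s})" by simp
  fix b \<sigma> \<tau> :: real
  assume a: "0 \<le> \<sigma> \<and> \<sigma> \<le> \<tau> \<and> \<tau> < b \<and> {\<sigma><..\<tau>} \<inter> (\<lambda>k. real k * e) ` {0..s} = {}"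
  define p where "p = nat \<lfloor>\<sigma> / e\<rfloor> + 1"
  define q where "q = nat \<lfloor>\<tau> / e\<rfloor> + 1"
  have se: "0 \<le> \<sigma> / e" "\<sigma> / e \<le> \<tau> / e" using a e by (auto simp: divide_right_mono)
  have pq: "p \<le> q" unfolding p_def q_def using se by (simp add: floor_mono nat_mono)
  have "min s p = min s q"
  proof (cases "p < q \<and> p \<le> s")
    case True
    have "real p = of_int \<lfloor>\<sigma> / e\<rfloor> + 1" using se by (simp add: p_def)
    then have "\<sigma> / e < real p" by linarith
    then have 1: "\<sigma> < real p * e" using e by (simp add: pos_divide_less_eq)
    have "int p \<le> \<lfloor>\<tau> / e\<rfloor>" using True se unfolding q_def by linarith
    then have "real p \<le> \<tau> / e" by linarith
    then have "real p * e \<le> \<tau>" using e by (simp add: pos_le_divide_eq)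
    with 1 have "real p * e \<in> {\<sigma><..\<tau>} \<inter> (\<lambda>k. real k * e) ` {0..s}" using True by auto
    then show ?thesis using a by blast
  next
    case False
    then show ?thesis using pq by auto
  qed
  then show "step_control T s w \<sigma> = step_control T s w \<tau>"
    by (simp add: step_control_def p_def q_def e_def)
qed

definition satisficing_solution ::
    "(real ^ ('m::{finite,linorder} + 'k::{finite,linorder}) option \<Rightarrow> 'x \<Rightarrow> 'x) \<Rightarrow>
     (('m + 'k) option \<Rightarrow> real ^ ('m + 'k) option \<Rightarrow> real ^ ('m + 'k) option) \<Rightarrow>
     (('m + 'k) option \<Rightarrow> real ^ ('m + 'k) option \<Rightarrow> real ^ ('m + 'k) option) \<Rightarrow>
     real \<Rightarrow> (real ^ ('m + 'k)) set \<Rightarrow> nat \<Rightarrow> (nat \<Rightarrow> real ^ 'm::{finite,linorder}) \<Rightarrow> bool"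
  where "satisficing_solution K \<mu> \<psi> T U s w \<longleftrightarrow> s \<ge> 1 \<and>
    (\<exists>G\<in>reach_gamma K \<mu> \<psi> T U. gamma_at K \<mu> \<psi> T (\<lambda>\<tau>. embed_u (step_control T s w \<tau>)) G)"

(* ubar x is the control on [0,T] computed at the sampled state x.  Up to finitely many instants,
   a trajectory on [t0,b] does not depend on the values of x outside [t0,b]. *)

definition concat_control ::
    "('a \<Rightarrow> real \<Rightarrow> 'u) \<Rightarrow> real \<Rightarrow> real \<Rightarrow> (real \<Rightarrow> 'a) \<Rightarrow> real \<Rightarrow> 'u"
  where "concat_control ubar T t0 x t =
    (let n = real_of_int \<lfloor>(t - t0) / T\<rfloor> in ubar (x (t0 + n * T)) (t - (t0 + n * T)))"

definition closed_loop_until ::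
    "('m::finite option \<Rightarrow> real ^ 'n \<Rightarrow> real ^ 'n) \<Rightarrow> (real ^ 'n \<Rightarrow> real \<Rightarrow> real ^ 'm) \<Rightarrow>
     real \<Rightarrow> real \<Rightarrow> real \<Rightarrow> (real \<Rightarrow> real ^ 'n) \<Rightarrow> bool"
  where "closed_loop_until f ubar T t0 b x \<longleftrightarrow>
    pw_solution (\<lambda>t. affine_field f (concat_control ubar T t0 x t)) x t0 b"

definition closed_loop ::
    "('m::finite option \<Rightarrow> real ^ 'n \<Rightarrow> real ^ 'n) \<Rightarrow> (real ^ 'n \<Rightarrow> real \<Rightarrow> real ^ 'm) \<Rightarrow>
     real \<Rightarrow> real \<Rightarrow> (real \<Rightarrow> real ^ 'n) \<Rightarrow> bool"
  where "closed_loop f ubar T t0 x \<longleftrightarrow> (\<forall>b\<ge>t0. closed_loop_until f ubar T t0 b x)"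

(* traj t0 x states that x is a trajectory on [t0,oo).  The first conjunct requires
   trajectories to exist from all initial states near the origin, so that the two stability
   properties are not vacuous. *)

definition uniformly_asymptotically_stable ::
    "(real \<Rightarrow> (real \<Rightarrow> 'a::real_normed_vector) \<Rightarrow> bool) \<Rightarrow> bool"
  where "uniformly_asymptotically_stable traj \<longleftrightarrow>
    (\<exists>\<delta>>0. \<forall>t0\<ge>0. \<forall>x0. norm x0 < \<delta> \<longrightarrow> (\<exists>x. traj t0 x \<and> x t0 = x0)) \<and>
    (\<forall>\<rho>>0. \<exists>\<delta>>0. \<forall>t0\<ge>0. \<forall>x. traj t0 x \<and> norm (x t0) < \<delta> \<longrightarrow>
      (\<forall>t\<ge>t0. norm (x t) < \<rho>)) \<and>
    (\<exists>N. open N \<and> 0 \<in> N \<and> (\<forall>x0\<in>N. \<forall>\<rho>>0. \<exists>\<theta>\<ge>0. \<forall>t0\<ge>0. \<forall>x. traj t0 x \<and> x t0 = x0 \<longrightarrow>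
      (\<forall>t\<ge>t0 + \<theta>. norm (x t) < \<rho>)))"

end

theory Submission
  imports Defs
begin

text \<open>
  A solution of the satisficing problem steers the group system to the same point \<open>S T\<close> of \<open>H\<close> as
  some constant control \<open>v\<close> in \<open>U\<^sup>e(x)\<close> steers the extended group system. Letting \<open>H\<close> act on \<open>x\<close> turns both
  curves in \<open>H\<close> into trajectories in \<open>\<real>\<^sup>n\<close>, so the closed loop moves from \<open>x\<close> to a point of
  \<open>R\<^sub>G(T, x, U\<^sup>e(x))\<close> during one period and \<open>V\<close> drops by at least \<open>(\<eta> / 2) T \<parallel>x\<parallel>\<^sup>2\<close> from one sampling
  instant to the next. Between sampling instants the bound on the control and \<open>f\<^sub>0(0) = 0\<close> give, by
  Gronwall's argument, \<open>\<parallel>x(t)\<parallel> \<le> \<kappa> \<parallel>x(t\<^sub>0 + nT)\<parallel>\<close> with a constant \<open>\<kappa>\<close>. The Lyapunov argument at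
  the sampling instants then yields stability and convergence that are uniform in \<open>t\<^sub>0\<close>.
\<close>

section \<open>Analytic maps are differentiable\<close>

text \<open>In finite dimension unconditional and absolute summability agree: they do for the real
  series of each coordinate, and the norm is at most the sum of the absolute coordinates.\<close>

lemma summable_on_imp_norm_summable_on:
  fixes f :: "'a \<Rightarrow> 'b::euclidean_space"
  assumes "f summable_on A"
  shows "(\<lambda>x. norm (f x)) summable_on A"
proof (rule Infinite_Sum.abs_summable_on_comparison_test')
  have "(\<lambda>x. \<bar>f x \<bullet> b\<bar>) summable_on A" if "b \<in> Basis" for b
    using summable_on_iff_abs_summable_on_real[THEN iffD1,
        OF summable_on_bounded_linear[OF bounded_linear_inner_left assms, of b]] by simp
  moreover have "(\<lambda>x. \<Sum>b\<in>D. \<bar>f x \<bullet> b\<bar>) summable_on A" if "finite D" "D \<subseteq> Basis" for D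
    using that calculation by (induction D) (auto intro: summable_on_add)
  ultimately show "(\<lambda>x. \<Sum>b\<in>Basis. \<bar>f x \<bullet> b\<bar>) summable_on A" by simp
  show "norm (f x) \<le> (\<Sum>b\<in>Basis. \<bar>f x \<bullet> b\<bar>)" for x
    by (rule norm_le_l1)
qed

lemma differentiable_prod:
  fixes g :: "'i \<Rightarrow> 'a::real_normed_vector \<Rightarrow> real"
  assumes "\<And>i. i \<in> D \<Longrightarrow> g i differentiable (at x)"
  shows "(\<lambda>y. \<Prod>i\<in>D. g i y) differentiable (at x)"
  using assms by (induction D rule: infinite_finite_induct) auto

text \<open>Taking \<open>y = x\<close> in the bound gives \<open>f x = 0\<close>, so the difference
  quotient is at most \<open>B * norm (y - x)\<close>. Serves for the tail of a power series from
  degree 2 on.\<close>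

lemma has_derivative_0_if_quadratic:
  fixes f :: "'a::real_normed_vector \<Rightarrow> 'b::real_normed_vector"
  assumes "d > 0" and le: "\<And>y. norm (y - x) < d \<Longrightarrow> norm (f y) \<le> B * (norm (y - x))\<^sup>2"
  shows "(f has_derivative (\<lambda>_. 0)) (at x)"
proof (rule has_derivativeI_sandwich)
  show "0 < d" by fact
  show "bounded_linear (\<lambda>_::'a. 0::'b)" by (rule bounded_linear_zero)
  have "f x = 0" using le[of x] \<open>d > 0\<close> by simp
  show "norm (f y - f x - 0) / norm (y - x) \<le> B * norm (y - x)"
    if "y \<in> UNIV" "y \<noteq> x" "dist y x < d" for y
    using le[of y] that \<open>f x = 0\<close>
    by (simp add: divide_le_eq dist_norm power2_eq_square mult.assoc)
  have "((\<lambda>y. B * norm (y - x)) \<longlongrightarrow> B * norm (x - x)) (at x)"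
    by (intro tendsto_intros)
  then show "((\<lambda>y. B * norm (y - x)) \<longlongrightarrow> 0) (at x)" by simp
qed

text \<open>The power of \<sigma> is the value of the monomial at the point whose coordinates all
  equal \<sigma>. Shrinking the argument by \<open>q\<close> gains a factor \<open>q ^ k\<close> on
  every monomial of degree at least \<open>k\<close>.\<close>

lemma norm_multi_power_le:
  fixes h :: "'a::euclidean_space"
  assumes "norm h \<le> q * \<sigma>" "0 \<le> q" "q \<le> 1" "0 \<le> \<sigma>" "k \<le> sum a Basis"
  shows "\<bar>\<Prod>b\<in>Basis. (h \<bullet> b) ^ a b\<bar> \<le> q ^ k * \<sigma> ^ sum a Basis"
proof -
  have "\<bar>\<Prod>b\<in>Basis. (h \<bullet> b) ^ a b\<bar> = (\<Prod>b\<in>Basis. \<bar>h \<bullet> b\<bar> ^ a b)"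
    by (simp add: abs_prod power_abs)
  also have "\<dots> \<le> (\<Prod>b\<in>Basis. (q * \<sigma>) ^ a b)"
  proof (intro prod_mono conjI power_mono)
    show "\<bar>h \<bullet> b\<bar> \<le> q * \<sigma>" if "b \<in> Basis" for b
      using Basis_le_norm[OF that, of h] assms(1) by linarith
  qed auto
  also have "\<dots> = q ^ sum a Basis * \<sigma> ^ sum a Basis"
    by (simp add: power_sum power_mult_distrib prod.distrib)
  also have "\<dots> \<le> q ^ k * \<sigma> ^ sum a Basis"
    using assms by (intro mult_right_mono power_decreasing) auto
  finally show ?thesis .
qed

text \<open>The terms of degree 0 and 1 form a finite, differentiable sum \<open>P\<close>. The
  others are bounded together by a multiple of the squared distance to \<open>x\<close>, so they
  contribute the derivative 0.\<close>

lemma real_analytic_imp_differentiable: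
  fixes f :: "'a::euclidean_space \<Rightarrow> 'b::euclidean_space"
  assumes "real_analytic f"
  shows "f differentiable (at x)"
proof -
  let ?I = "Basis \<rightarrow>\<^sub>E (UNIV :: nat set) :: ('a \<Rightarrow> nat) set"
  let ?m = "\<lambda>h a. \<Prod>b\<in>Basis. (h \<bullet> b :: real) ^ a b"
  obtain \<rho> c where "\<rho> > 0"
    and sums: "\<And>y. y \<in> ball x \<rho> \<Longrightarrow> ((\<lambda>a. ?m (y - x) a *\<^sub>R c a) has_sum f y) ?I"
  proof -
    from assms obtain \<rho> where "\<rho> > 0"
      and "\<exists>c. \<forall>y\<in>ball x \<rho>. ((\<lambda>a. ?m (y - x) a *\<^sub>R c a) has_sum f y) ?I"
      unfolding real_analytic_def by blast
    then show ?thesis by (elim exE) (rule that, assumption, rule bspec)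
  qed
  \<comment> \<open>The l1 norm of \<open>h0\<close>, whose coordinates all equal \<sigma>, is then
    half of \<rho>, so \<open>x + h0\<close> lies in the ball of convergence. Absolute convergence
    at this one point dominates the series wherever
    \<open>norm (y - x) \<le> \<sigma>\<close>.\<close>
  define \<sigma> where "\<sigma> = \<rho> / (2 * DIM('a))"
  have \<sigma>: "\<sigma> > 0" using \<open>\<rho> > 0\<close> by (simp add: \<sigma>_def)
  define h0 :: 'a where "h0 = (\<Sum>b\<in>Basis. \<sigma> *\<^sub>R b)"
  have h0: "h0 \<bullet> b = \<sigma>" if "b \<in> Basis" for b
    using that by (simp add: h0_def inner_sum_left_Basis)
  have "norm h0 \<le> (\<Sum>b\<in>Basis. \<bar>h0 \<bullet> b\<bar>)" by (rule norm_le_l1)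
  also have "\<dots> < \<rho>" using h0 \<sigma> \<open>\<rho> > 0\<close> by (simp add: \<sigma>_def)
  finally have "x + h0 \<in> ball x \<rho>" by (simp add: dist_norm)
  then have "(\<lambda>a. norm (?m h0 a *\<^sub>R c a)) summable_on ?I"
    using sums[of "x + h0"] by (intro summable_on_imp_norm_summable_on) (auto simp: summable_on_def)
  moreover have "norm (?m h0 a *\<^sub>R c a) = \<sigma> ^ sum a Basis * norm (c a)" for a
    using h0 \<sigma> by (simp add: power_sum abs_prod)
  ultimately have summ: "(\<lambda>a. \<sigma> ^ sum a Basis * norm (c a)) summable_on ?I" by (simp only:)
  define I1 where "I1 = {a \<in> ?I. sum a Basis < 2}"
  have "I1 \<subseteq> Basis \<rightarrow>\<^sub>E {..<2}"
  proof
    fix a assume a: "a \<in> I1"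
    have "a b < 2" if "b \<in> Basis" for b
      using member_le_sum[of b Basis a] that a by (auto simp: I1_def)
    with a show "a \<in> Basis \<rightarrow>\<^sub>E {..<2}" by (auto simp: I1_def PiE_iff)
  qed
  then have fin: "finite I1" by (rule finite_subset) (simp add: finite_PiE)
  define P where "P = (\<lambda>y. \<Sum>a\<in>I1. ?m (y - x) a *\<^sub>R c a)"
  define S where "S = infsum (\<lambda>a. \<sigma> ^ sum a Basis * norm (c a)) (?I - I1)"
  have S: "((\<lambda>a. \<sigma> ^ sum a Basis * norm (c a)) has_sum S) (?I - I1)"
    unfolding S_def by (intro has_sum_infsum summable_on_subset_banach[OF summ]) auto
  have rest: "norm (f y - P y) \<le> S / \<sigma>\<^sup>2 * (norm (y - x))\<^sup>2" if "norm (y - x) < min \<rho> \<sigma>" for y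
  proof -
    define q where "q = norm (y - x) / \<sigma>"
    have q: "0 \<le> q" "q \<le> 1" "norm (y - x) \<le> q * \<sigma>" using that \<sigma> by (auto simp: q_def)
    have "((\<lambda>a. ?m (y - x) a *\<^sub>R c a) has_sum (f y - P y)) (?I - I1)"
      unfolding P_def using that fin
      by (intro has_sum_Diff sums has_sum_finite) (auto simp: dist_norm norm_minus_commute I1_def)
    moreover have "((\<lambda>a. q\<^sup>2 * (\<sigma> ^ sum a Basis * norm (c a))) has_sum q\<^sup>2 * S) (?I - I1)"
      by (rule has_sum_cmult_right[OF S])
    ultimately have "norm (f y - P y) \<le> q\<^sup>2 * S"
    proof (rule norm_infsum_le)
      fix a assume "a \<in> ?I - I1"
      then have "2 \<le> sum a Basis" by (auto simp: I1_def)
      then have "\<bar>?m (y - x) a\<bar> \<le> q\<^sup>2 * \<sigma> ^ sum a Basis"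
        using q \<sigma> by (intro norm_multi_power_le) auto
      then show "norm (?m (y - x) a *\<^sub>R c a) \<le> q\<^sup>2 * (\<sigma> ^ sum a Basis * norm (c a))"
        by (simp add: mult_right_mono flip: mult.assoc)
    qed
    then show ?thesis by (simp add: q_def power_divide mult.commute)
  qed
  have "((\<lambda>y. f y - P y) has_derivative (\<lambda>_. 0)) (at x)"
    by (rule has_derivative_0_if_quadratic[where d = "min \<rho> \<sigma>" and B = "S / \<sigma>\<^sup>2"])
       (use rest \<sigma> \<open>\<rho> > 0\<close> in auto)
  moreover have "P differentiable (at x)"
  proof -
    have "((\<lambda>y. (y - x) \<bullet> b) has_derivative (\<lambda>h. h \<bullet> b)) (at x)" for b
      by (auto intro!: derivative_eq_intros)
    then have "(\<lambda>y. ?m (y - x) a) differentiable (at x)" for a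
      by (intro differentiable_prod differentiable_power) (auto simp: differentiable_def)
    then show ?thesis
      unfolding P_def by (intro differentiable_sum differentiable_scaleR fin ballI) auto
  qed
  ultimately have "(\<lambda>y. (f y - P y) + P y) differentiable (at x)"
    by (intro differentiable_add) (auto simp: differentiable_def)
  then show ?thesis by simp
qed

section \<open>Piecewise differentiable solutions\<close>

lemma pw_solutionI:
  assumes "continuous_on {a..b} x" "finite D"
    and "\<And>t. t \<in> {a..b} - D \<Longrightarrow> (x has_vector_derivative F t (x t)) (at t within {a..b})"
  shows "pw_solution F x a b"
  unfolding pw_solution_def using assms by (intro conjI exI[of _ D]) auto

lemma pw_solutionE:
  assumes "pw_solution F x a b"
  obtains D where "continuous_on {a..b} x" "finite D"
    and "\<And>t. t \<in> {a..b} - D \<Longrightarrow> (x has_vector_derivative F t (x t)) (at t within {a..b})"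
  using assms unfolding pw_solution_def by (elim conjE exE) (rule that, auto)

lemma pw_solution_refl: "pw_solution F x a a"
  by (rule pw_solutionI[where D = "{a}"]) auto

lemma pw_solution_subset:
  assumes "pw_solution F x a b" "a \<le> c" "d \<le> b"
  shows "pw_solution F x c d"
proof -
  have sub: "{c..d} \<subseteq> {a..b}" using assms by auto
  obtain D where "continuous_on {a..b} x" "finite D"
    and der: "\<And>t. t \<in> {a..b} - D \<Longrightarrow> (x has_vector_derivative F t (x t)) (at t within {a..b})"
    using assms(1) by (elim pw_solutionE) (rule that)
  show ?thesis
  proof (rule pw_solutionI)
    show "continuous_on {c..d} x" by (rule continuous_on_subset[OF \<open>continuous_on {a..b} x\<close> sub])
    show "finite D" by fact
    show "(x has_vector_derivative F t (x t)) (at t within {c..d})" if "t \<in> {c..d} - D" for t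
      by (rule has_vector_derivative_within_subset[OF der sub]) (use that sub in auto)
  qed
qed

text \<open>The finite set \<open>E\<close> allows for sampling instants, at which the concatenated
  control already takes its value for the next period.\<close>

lemma pw_solution_cong:
  assumes "pw_solution F x a b" "finite E"
    and xy: "\<And>t. t \<in> {a..b} \<Longrightarrow> y t = x t"
    and FG: "\<And>t. t \<in> {a..b} - E \<Longrightarrow> G t (x t) = F t (x t)"
  shows "pw_solution G y a b"
proof -
  obtain D where cont: "continuous_on {a..b} x" and "finite D"
    and der: "\<And>t. t \<in> {a..b} - D \<Longrightarrow> (x has_vector_derivative F t (x t)) (at t within {a..b})"
    using assms(1) by (elim pw_solutionE) (rule that)
  show ?thesis
  proof (rule pw_solutionI)
    show "continuous_on {a..b} y" by (rule continuous_on_eq[OF cont]) (simp add: xy)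
    show "finite (D \<union> E)" using \<open>finite D\<close> \<open>finite E\<close> by simp
    fix t assume t: "t \<in> {a..b} - (D \<union> E)"
    have "(x has_vector_derivative G t (y t)) (at t within {a..b})"
      using der[of t] FG[of t] xy[of t] t by simp
    then show "(y has_vector_derivative G t (y t)) (at t within {a..b})"
      by (rule has_vector_derivative_transform[rotated 2]) (use t xy in auto)
  qed
qed

lemma pw_solution_shift:
  assumes "pw_solution F x a b"
  shows "pw_solution (\<lambda>t. F (t + c)) (\<lambda>t. x (t + c)) (a - c) (b - c)"
proof -
  obtain D where cont: "continuous_on {a..b} x" and "finite D"
    and der: "\<And>t. t \<in> {a..b} - D \<Longrightarrow> (x has_vector_derivative F t (x t)) (at t within {a..b})"
    using assms by (elim pw_solutionE) (rule that)
  have img: "(\<lambda>t. t + c) ` {a - c..b - c} = {a..b}" by simp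
  show ?thesis
  proof (rule pw_solutionI)
    show "continuous_on {a - c..b - c} (\<lambda>t. x (t + c))"
      by (rule continuous_on_compose2[OF cont]) (auto intro!: continuous_intros)
    show "finite ((\<lambda>t. t - c) ` D)" using \<open>finite D\<close> by simp
    fix t assume t: "t \<in> {a - c..b - c} - (\<lambda>t. t - c) ` D"
    then have "t + c \<in> {a..b} - D" by (auto simp: image_iff)
    from der[OF this] have "(x has_vector_derivative F (t + c) (x (t + c)))
        (at (t + c) within (\<lambda>t. t + c) ` {a - c..b - c})"
      unfolding img .
    moreover have "((\<lambda>t. t + c) has_vector_derivative 1) (at t within {a - c..b - c})"
      by (auto intro!: derivative_eq_intros)
    ultimately show "((\<lambda>t. x (t + c)) has_vector_derivative F (t + c) (x (t + c)))
        (at t within {a - c..b - c})"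
      using vector_diff_chain_within[of "\<lambda>t. t + c" 1 t "{a - c..b - c}" x] by (simp add: o_def)
  qed
qed

text \<open>The junction \<open>b\<close> joins the exceptional set, since the one-sided derivatives
  there may differ. Away from it, the filter within the long interval equals the one within a short
  interval.\<close>

lemma pw_solution_join:
  assumes ab: "pw_solution F x a b" and bc: "pw_solution F x b c" and le: "a \<le> b" "b \<le> c"
  shows "pw_solution F x a c"
proof -
  have un: "{a..b} \<union> {b..c} = {a..c}" using le by auto
  obtain D where cont: "continuous_on {a..b} x" and "finite D"
    and der: "\<And>t. t \<in> {a..b} - D \<Longrightarrow> (x has_vector_derivative F t (x t)) (at t within {a..b})"
    using ab by (elim pw_solutionE) (rule that)
  obtain D' where cont': "continuous_on {b..c} x" and "finite D'"
    and der': "\<And>t. t \<in> {b..c} - D' \<Longrightarrow> (x has_vector_derivative F t (x t)) (at t within {b..c})"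
    using bc by (elim pw_solutionE) (rule that)
  show ?thesis
  proof (rule pw_solutionI)
    show "continuous_on {a..c} x"
      using continuous_on_closed_Un[OF _ _ cont cont'] un by simp
    show "finite (D \<union> D' \<union> {b})" using \<open>finite D\<close> \<open>finite D'\<close> by simp
    fix t assume t: "t \<in> {a..c} - (D \<union> D' \<union> {b})"
    show "(x has_vector_derivative F t (x t)) (at t within {a..c})"
    proof (cases "t < b")
      case True
      have "at t within {a..c} = at t within {a..b}"
        by (rule at_within_nhd[of t "{..<b}"]) (use True le in auto)
      then show ?thesis using der[of t] t True by auto
    next
      case False
      have "at t within {a..c} = at t within {b..c}"
        by (rule at_within_nhd[of t "{b<..}"]) (use False t le in auto)
      then show ?thesis using der'[of t] t False by auto
    qed
  qed
qed

text \<open>For a continuous function the fundamental theorem of calculus tolerates finitely many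
  exceptional points; the derivative, set to 0 there, has a nonpositive integral.\<close>

lemma nonincreasing_if_derivative_nonpos_piecewise:
  fixes \<phi> :: "real \<Rightarrow> real"
  assumes "finite D" "a \<le> b" "continuous_on {a..b} \<phi>"
    and "\<And>t. t \<in> {a<..<b} - D \<Longrightarrow> \<exists>d\<le>0. (\<phi> has_vector_derivative d) (at t)"
  shows "\<phi> b \<le> \<phi> a"
proof -
  obtain d where d: "\<And>t. t \<in> {a<..<b} - D \<Longrightarrow> d t \<le> 0 \<and> (\<phi> has_vector_derivative d t) (at t)"
    using assms(4) by metis
  define d' where "d' = (\<lambda>t. if t \<in> {a<..<b} - D then d t else 0)"
  have "(d' has_integral (\<phi> b - \<phi> a)) {a..b}"
    by (rule fundamental_theorem_of_calculus_interior_strong[OF assms(1,2)])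
       (use d assms(3) in \<open>auto simp: d'_def\<close>)
  moreover have "d' t \<le> 0" for t using d by (simp add: d'_def)
  ultimately have "\<phi> b - \<phi> a \<le> 0"
    by (rule has_integral_le[OF _ has_integral_0])
  then show ?thesis by simp
qed

section \<open>Growth of solutions between sampling instants\<close>

(* Gronwall: exp (- (2 L + c) t) (|xi t|^2 + |xi 0|^2) is nonincreasing. *)
lemma pw_solution_growth_in_ball:
  fixes \<xi> :: "real \<Rightarrow> 'a::euclidean_space"
  assumes sol: "pw_solution F \<xi> 0 T" and "0 \<le> L" "0 \<le> c"
    and le: "\<And>t q. t \<in> {0..T} \<Longrightarrow> norm q \<le> r \<Longrightarrow> norm (F t q) \<le> L * norm q + c * norm (\<xi> 0)"
    and \<tau>: "\<tau> \<in> {0..T}" and small: "\<And>t. t \<in> {0..\<tau>} \<Longrightarrow> norm (\<xi> t) \<le> r"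
  shows "norm (\<xi> \<tau>) \<le> sqrt (2 * exp ((2 * L + c) * T)) * norm (\<xi> 0)"
\<comment> \<open>In the derivative of the squared norm, the part \<open>2 * L\<close> of
  \<open>k\<close> absorbs the homogeneous term, and \<open>c\<close> absorbs the mixed term
  \<open>2 * c * norm (\<xi> t) * n\<close> by 2ab \<le> a^2 + b^2.\<close>
proof -
  define k where "k = 2 * L + c"
  define n where "n = norm (\<xi> 0)"
  \<comment> \<open>The added square of \<open>n\<close> compensates the term of the bound that does
    not shrink with \<open>\<xi> t\<close>. It doubles the initial value, whence the 2 under the
    root.\<close>
  define \<phi> where "\<phi> = (\<lambda>t. exp (- k * t) * (\<xi> t \<bullet> \<xi> t + n\<^sup>2))"
  obtain D where cont: "continuous_on {0..T} \<xi>" and "finite D"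
    and der: "\<And>t. t \<in> {0..T} - D \<Longrightarrow> (\<xi> has_vector_derivative F t (\<xi> t)) (at t within {0..T})"
    using sol by (elim pw_solutionE) (rule that)
  have "\<phi> \<tau> \<le> \<phi> 0"
  proof (rule nonincreasing_if_derivative_nonpos_piecewise[of D 0 \<tau> \<phi>])
    show "finite D" by fact
    show "0 \<le> \<tau>" using \<tau> by simp
    show "continuous_on {0..\<tau>} \<phi>"
      unfolding \<phi>_def using \<tau> by (intro continuous_intros continuous_on_subset[OF cont]) auto
    fix t assume t: "t \<in> {0<..<\<tau>} - D"
    then have "at t within {0..T} = at t" using \<tau> by (intro at_within_Icc_at) auto
    with der[of t] t \<tau> have \<xi>': "(\<xi> has_vector_derivative F t (\<xi> t)) (at t)" by auto
    let ?d = "exp (- k * t) * (2 * (\<xi> t \<bullet> F t (\<xi> t)) - k * (\<xi> t \<bullet> \<xi> t + n\<^sup>2))"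
    have "((\<lambda>t. \<xi> t \<bullet> \<xi> t) has_vector_derivative 2 * (\<xi> t \<bullet> F t (\<xi> t))) (at t)"
      using bounded_bilinear.has_vector_derivative[OF bounded_bilinear_inner \<xi>' \<xi>']
      by (simp add: inner_commute)
    then have "((\<lambda>t. \<xi> t \<bullet> \<xi> t) has_real_derivative 2 * (\<xi> t \<bullet> F t (\<xi> t))) (at t)"
      by (simp add: has_real_derivative_iff_has_vector_derivative)
    then have "(\<phi> has_real_derivative ?d) (at t)"
      unfolding \<phi>_def by (auto intro!: derivative_eq_intros simp: algebra_simps)
    then have "(\<phi> has_vector_derivative ?d) (at t)"
      by (simp add: has_real_derivative_iff_has_vector_derivative)
    moreover have "?d \<le> 0"
    proof -
      have "\<xi> t \<bullet> F t (\<xi> t) \<le> norm (\<xi> t) * norm (F t (\<xi> t))" by (rule norm_cauchy_schwarz)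
      also have "\<dots> \<le> norm (\<xi> t) * (L * norm (\<xi> t) + c * n)"
        using t \<tau> le[of t "\<xi> t"] small[of t] by (intro mult_left_mono) (auto simp: n_def)
      finally have "2 * (\<xi> t \<bullet> F t (\<xi> t)) \<le> 2 * L * (norm (\<xi> t))\<^sup>2 + c * (2 * norm (\<xi> t) * n)"
        by (simp add: algebra_simps power2_eq_square)
      also have "\<dots> \<le> 2 * L * ((norm (\<xi> t))\<^sup>2 + n\<^sup>2) + c * ((norm (\<xi> t))\<^sup>2 + n\<^sup>2)"
        using assms(2,3) by (intro add_mono mult_left_mono sum_squares_bound) auto
      finally have "2 * (\<xi> t \<bullet> F t (\<xi> t)) - k * (\<xi> t \<bullet> \<xi> t + n\<^sup>2) \<le> 0"
        by (simp add: k_def algebra_simps power2_norm_eq_inner)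
      then show ?thesis by (intro mult_nonneg_nonpos) auto
    qed
    ultimately show "\<exists>d\<le>0. (\<phi> has_vector_derivative d) (at t)" by blast
  qed
  then have "\<xi> \<tau> \<bullet> \<xi> \<tau> + n\<^sup>2 \<le> exp (k * \<tau>) * (2 * n\<^sup>2)"
    by (simp add: \<phi>_def n_def power2_norm_eq_inner exp_minus field_simps)
  also have "\<dots> \<le> exp (k * T) * (2 * n\<^sup>2)"
    using \<tau> assms(2,3) by (intro mult_right_mono) (auto simp: k_def mult_left_mono)
  finally have "\<xi> \<tau> \<bullet> \<xi> \<tau> \<le> exp (k * T) * (2 * n\<^sup>2)"
    using zero_le_power2[of n] by linarith
  then have "(norm (\<xi> \<tau>))\<^sup>2 \<le> 2 * exp (k * T) * n\<^sup>2"
    by (simp add: power2_norm_eq_inner mult.assoc mult.left_commute)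
  then have "norm (\<xi> \<tau>) \<le> sqrt (2 * exp (k * T) * n\<^sup>2)" by (rule real_le_rsqrt)
  then show ?thesis by (simp add: real_sqrt_mult k_def n_def)
qed

text \<open>A bootstrap: the growth estimate needs the curve to stay in the ball of radius
  \<open>r\<close>, and the estimate itself keeps it there. At the first instant where the norm
  reaches \<open>r\<close>, it would give a norm below \<open>r\<close>.\<close>

lemma pw_solution_growth:
  fixes \<xi> :: "real \<Rightarrow> 'a::euclidean_space"
    and L c T r :: real
  defines "\<kappa> \<equiv> sqrt (2 * exp ((2 * L + c) * T))"
  assumes sol: "pw_solution F \<xi> 0 T" and "0 \<le> L" "0 \<le> c"
    and le: "\<And>t q. t \<in> {0..T} \<Longrightarrow> norm q \<le> r \<Longrightarrow> norm (F t q) \<le> L * norm q + c * norm (\<xi> 0)"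
    and small: "\<kappa> * norm (\<xi> 0) < r" and t: "t \<in> {0..T}"
  shows "norm (\<xi> t) \<le> \<kappa> * norm (\<xi> 0)"
proof -
  note growth = pw_solution_growth_in_ball[OF sol \<open>0 \<le> L\<close> \<open>0 \<le> c\<close> le, folded \<kappa>_def]
  have cont: "continuous_on {0..T} (\<lambda>t. norm (\<xi> t))"
    using sol by (auto simp: pw_solution_def intro!: continuous_intros)
  have "norm (\<xi> t) < r" if "t \<in> {0..T}" for t
  proof (rule ccontr)
    assume "\<not> norm (\<xi> t) < r"
    define A where "A = {0..T} \<inter> (\<lambda>s. norm (\<xi> s)) -` {r..}"
    have "closed A"
      unfolding A_def by (intro continuous_closed_preimage[OF cont] closed_atLeastAtMost closed_atLeast)
    have "t \<in> A" using that \<open>\<not> norm (\<xi> t) < r\<close> by (simp add: A_def)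
    have bdd: "bdd_below A" by (auto simp: A_def intro: bdd_belowI[of _ 0])
    define s where "s = Inf A"
    have "s \<in> A" unfolding s_def using closed_contains_Inf[OF _ bdd \<open>closed A\<close>] \<open>t \<in> A\<close> by blast
    then have s: "0 \<le> s" "s \<le> T" "r \<le> norm (\<xi> s)" by (auto simp: A_def)
    have below: "norm (\<xi> a) < r" if "0 \<le> a" "a < s" for a
      using cInf_lower[OF _ bdd, of a] that s by (force simp: s_def A_def)
    \<comment> \<open>Since \<kappa> is at least 1, the curve starts within the ball. By the
      intermediate value theorem the norm is then exactly \<open>r\<close> at \<open>s\<close>, so
      the estimate is applicable up to and including \<open>s\<close>.\<close>
    have "1 \<le> exp ((2 * L + c) * T)"
      using assms(3,4) that by simp
    then have "1 \<le> \<kappa>"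
      unfolding \<kappa>_def real_sqrt_ge_1_iff by linarith
    then have "norm (\<xi> 0) \<le> \<kappa> * norm (\<xi> 0)" 
      using mult_right_mono[of 1 "\<kappa>" "norm (\<xi> 0)"] by simp
    then have "norm (\<xi> 0) \<le> r" using small by simp
    then obtain a where a: "0 \<le> a" "a \<le> s" "norm (\<xi> a) = r"
      using IVT'[of "\<lambda>t. norm (\<xi> t)" 0 r s] s continuous_on_subset[OF cont, of "{0..s}"] by auto
    then have "a = s" using below[of a] by force
    then have "norm (\<xi> s) \<le> \<kappa> * norm (\<xi> 0)"
      using a s below by (intro growth) (auto simp: le_less)
    then show False using s small by simp
  qed
  then show ?thesis using t by (intro growth) (auto intro: less_imp_le)
qed

text \<open>The drift vanishes and is differentiable at 0, hence is at most a multiple of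
  \<open>norm q\<close> nearby (tolerance 1 around the linear part \<open>A\<close>). The control
  fields are merely bounded near 0 by continuity.\<close>

lemma affine_field_local_bound:
  fixes f :: "'i::finite option \<Rightarrow> 'a::real_normed_vector \<Rightarrow> 'a"
  assumes "f None differentiable (at 0)" "f None 0 = 0" "\<And>i. isCont (f (Some i)) 0"
  obtains r L B where "r > 0" "L \<ge> 0" "B \<ge> 0"
    and "\<And>u q. norm q \<le> r \<Longrightarrow> norm (affine_field f u q) \<le> L * norm q + B * norm u"
proof -
  obtain A where "bounded_linear A"
    and "\<forall>e>0. \<exists>d>0. \<forall>q. norm q < d \<longrightarrow> norm (f None q - A q) \<le> e * norm q"
    using assms(1,2) unfolding differentiable_def has_derivative_at_alt by auto
  then obtain d where "d > 0" and d: "\<And>q. norm q < d \<Longrightarrow> norm (f None q - A q) \<le> norm q"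
    by (metis mult_1 zero_less_one)
  obtain a where "a > 0" and a: "\<And>q. norm (A q) \<le> norm q * a"
    using bounded_linear.pos_bounded[OF \<open>bounded_linear A\<close>] by blast
  \<comment> \<open>The added 1 makes the bound strict at 0, so it persists in a
    neighbourhood.\<close>
  define b where "b = (\<lambda>i. norm (f (Some i) 0) + 1)"
  have "\<forall>\<^sub>F q in at 0. norm (f (Some i) q) < b i" for i
    using tendsto_norm[OF assms(3)[of i, unfolded isCont_def]]
    by (rule order_tendstoD) (simp add: b_def)
  then have "\<forall>\<^sub>F q in at 0. \<forall>i\<in>UNIV. norm (f (Some i) q) < b i"
    by (intro eventually_ball_finite) auto
  then obtain e where "e > 0" and e: "\<And>q i. q \<noteq> 0 \<Longrightarrow> norm q < e \<Longrightarrow> norm (f (Some i) q) < b i"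
    unfolding eventually_at by (auto simp: dist_norm)
  have e': "norm (f (Some i) q) \<le> b i" if "norm q < e" for i q
    using e[of q i] that by (cases "q = 0") (auto simp: b_def)
  show ?thesis
  proof
    show "min d e / 2 > 0" "1 + a \<ge> 0" "sum b UNIV \<ge> 0"
      using \<open>d > 0\<close> \<open>e > 0\<close> \<open>a > 0\<close> by (auto simp: b_def intro!: sum_nonneg)
    fix u and q :: 'a assume "norm q \<le> min d e / 2"
    then have q: "norm q < d" "norm q < e" using \<open>d > 0\<close> \<open>e > 0\<close> by auto
    have "norm (f None q) \<le> norm (f None q - A q) + norm (A q)"
      by (metis diff_add_cancel norm_triangle_ineq)
    also have "\<dots> \<le> (1 + a) * norm q" using d[OF q(1)] a[of q] by (simp add: algebra_simps)
    finally have 1: "norm (f None q) \<le> (1 + a) * norm q" .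
    have "norm (\<Sum>i\<in>UNIV. (u $ i) *\<^sub>R f (Some i) q) \<le> (\<Sum>i\<in>UNIV. norm u * b i)"
    proof (rule sum_norm_le)
      show "norm ((u $ i) *\<^sub>R f (Some i) q) \<le> norm u * b i" for i
        using component_le_norm_cart[of u i] e'[OF q(2), of i] by (auto intro!: mult_mono)
    qed
    also have "\<dots> = sum b UNIV * norm u" by (simp add: sum_distrib_left mult.commute)
    finally have 2: "norm (\<Sum>i\<in>UNIV. (u $ i) *\<^sub>R f (Some i) q) \<le> sum b UNIV * norm u" .
    show "norm (affine_field f u q) \<le> (1 + a) * norm q + sum b UNIV * norm u"
      unfolding affine_field_def using norm_triangle_ineq 1 2 by (rule order_trans[OF _ add_mono])
  qed
qed

section \<open>The group action carries solutions on the group to solutions of the system\<close>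

lemma has_vector_derivative_compose_has_derivative:
  assumes "(f has_vector_derivative f') (at t within S)" "(g has_derivative D) (at (f t))"
  shows "((\<lambda>t. g (f t)) has_vector_derivative D f') (at t within S)"
proof -
  have "((\<lambda>t. g (f t)) has_derivative (\<lambda>h. D (h *\<^sub>R f'))) (at t within S)"
    using has_derivative_compose[OF assms(1)[unfolded has_vector_derivative_def] assms(2)] .
  then show ?thesis
    using linear_cmul[OF has_derivative_linear[OF assms(2)]]
    by (simp add: has_vector_derivative_def)
qed

lemma has_derivative_slice_fst:
  assumes "((\<lambda>(y, z). F y z) has_derivative D) (at (y, z))"
  shows "((\<lambda>y. F y z) has_derivative (\<lambda>h. D (h, 0))) (at y)"
  using has_derivative_compose[OF has_derivative_Pair[OF has_derivative_ident has_derivative_const] assms]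
  by simp

lemma has_derivative_slice_snd:
  assumes "((\<lambda>(y, z). F y z) has_derivative D) (at (y, z))"
  shows "((\<lambda>z. F y z) has_derivative (\<lambda>h. D (0, h))) (at z)"
  using has_derivative_compose[OF has_derivative_Pair[OF has_derivative_const has_derivative_ident] assms]
  by simp

lemma differentiable_slice_fst:
  assumes "(\<lambda>(y, z). F y z) differentiable (at (y, z))"
  shows "(\<lambda>y. F y z) differentiable (at y)"
  using assms unfolding differentiable_def
  by (elim exE) (rule exI, rule has_derivative_slice_fst)

context
  fixes H :: "(real ^ 'n \<Rightarrow> real ^ 'n) set"
    and K :: "real ^ 'r \<Rightarrow> real ^ 'n \<Rightarrow> real ^ 'n"
  assumes group: "analytic_transformation_group H K"
begin

lemma chart_group: "group (transformation_group H)"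
  and chart_bij: "bij_betw K UNIV H"
  using group by (auto simp: analytic_transformation_group_def)

lemma range_chart: "range K = H"
  using chart_bij by (simp add: bij_betw_def)

lemma chart_coord: "h \<in> H \<Longrightarrow> K (coord K h) = h"
  unfolding coord_def range_chart[symmetric] by (rule f_inv_into_f)

lemma coord_chart: "coord K (K y) = y"
  using chart_bij by (simp add: coord_def bij_betw_def)

lemma chart_mem: "K y \<in> H"
  unfolding range_chart[symmetric] by (rule rangeI)

lemma chart_chart_mult: "K (chart_mult K y z) = K y \<circ> K z"
proof -
  have "K y \<circ> K z \<in> H"
    using monoid.m_closed[OF group.is_monoid[OF chart_group], of "K y" "K z"]
    by (simp add: transformation_group_def chart_mem)
  then show ?thesis unfolding chart_mult_def by (rule chart_coord)
qed

lemma chart_chart_unit: "K (chart_unit K) = id"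
proof -
  have "id \<in> H"
    using monoid.one_closed[OF group.is_monoid[OF chart_group]]
    by (simp add: transformation_group_def)
  then show ?thesis unfolding chart_unit_def by (rule chart_coord)
qed

lemma chart_mult_unit_left: "chart_mult K (chart_unit K) y = y"
  by (simp add: chart_mult_def chart_chart_unit coord_chart)

text \<open>The inverse is passed through its chart coordinates, so that it can be differentiated
  together with the action. Used once more at the inverse itself, the identity shows that the
  inverse is injective.\<close>

lemma chart_inverse:
  "K (coord K (m_inv (transformation_group H) (K y))) (K y p) = p"
proof -
  have y: "K y \<in> carrier (transformation_group H)"
    by (simp add: transformation_group_def chart_mem)
  have "m_inv (transformation_group H) (K y) \<in> H"
    using group.inv_closed[OF chart_group y] by (simp add: transformation_group_def)
  then have "K (coord K (m_inv (transformation_group H) (K y))) = m_inv (transformation_group H) (K y)"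
    by (rule chart_coord)
  moreover have "m_inv (transformation_group H) (K y) \<circ> K y = id"
    using group.l_inv[OF chart_group y] by (simp add: transformation_group_def)
  ultimately have "K (coord K (m_inv (transformation_group H) (K y))) \<circ> K y = id"
    by (simp only:)
  then show ?thesis by (simp add: fun_eq_iff)
qed

lemma action_differentiable: "(\<lambda>(y, p). K y p) differentiable (at yp)"
  by (rule real_analytic_imp_differentiable)
    (use group in \<open>simp add: analytic_transformation_group_def\<close>)

lemma chart_mult_differentiable: "(\<lambda>(y, z). chart_mult K y z) differentiable (at yz)"
  by (rule real_analytic_imp_differentiable)
    (use group in \<open>simp add: analytic_transformation_group_def\<close>)

lemma chart_inverse_differentiable:
  "(\<lambda>y. coord K (m_inv (transformation_group H) (K y))) differentiable (at y)"
  by (rule real_analytic_imp_differentiable)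
    (use group in \<open>simp add: analytic_transformation_group_def\<close>)

lemma orbit_differentiable: "(\<lambda>y. K y p) differentiable (at y)"
  by (rule differentiable_slice_fst[OF action_differentiable])

(* Differentiate K (chart_mult z y) p = K z (K y p) in z at the unit. *)
lemma orbit_derivative_right_translate:
  assumes D: "((\<lambda>y. K y p) has_derivative D) (at y)"
  shows "D (right_translate K Y y) = frechet_derivative (\<lambda>z. K z (K y p)) (at (chart_unit K)) Y"
proof -
  let ?e = "chart_unit K"
  have "(\<lambda>z. chart_mult K z y) differentiable (at ?e)"
    by (rule differentiable_slice_fst[OF chart_mult_differentiable])
  then have "((\<lambda>z. chart_mult K z y) has_derivative
      frechet_derivative (\<lambda>z. chart_mult K z y) (at ?e)) (at ?e)"
    by (simp add: frechet_derivative_works)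
  from has_derivative_compose[OF this] D
  have "((\<lambda>z. K (chart_mult K z y) p) has_derivative (\<lambda>Y. D (right_translate K Y y))) (at ?e)"
    by (simp add: chart_mult_unit_left right_translate_def)
  then show ?thesis
    by (simp add: chart_chart_mult frechet_derivative_at[symmetric])
qed

lemma orbit_derivative_at_unit:
  "frechet_derivative (\<lambda>z. K z q) (at (chart_unit K)) (\<Sum>i\<in>I. c i *\<^sub>R \<mu> i (chart_unit K))
    = (\<Sum>i\<in>I. c i *\<^sub>R action_field K (\<mu> i) q)"
proof -
  have "linear (frechet_derivative (\<lambda>z. K z q) (at (chart_unit K)))"
    by (rule linear_frechet_derivative[OF orbit_differentiable])
  then show ?thesis by (simp add: linear_sum linear_cmul action_field_def)
qed

text \<open>The orbit map of \<open>p\<close> sends a right-translated tangent vector at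
  \<open>y\<close> to the value at \<open>K y p\<close> of the field it induces, by
  \<open>orbit_derivative_right_translate\<close>. The chain rule then pushes the curve from the
  group to the state space.\<close>

lemma group_solution_action:
  assumes "group_solution K \<mu> w S T"
  shows "pw_solution (\<lambda>t q. \<Sum>i\<in>UNIV. (w t $ i) *\<^sub>R action_field K (\<mu> i) q) (\<lambda>t. S t p) 0 T"
proof -
  let ?y = "\<lambda>t. coord K (S t)"
  have S: "K (?y t) = S t" if "t \<in> {0..T}" for t
    using assms that chart_coord range_chart by (simp add: group_solution_def)
  from assms have "pw_solution
      (\<lambda>t. right_translate K (\<Sum>i\<in>UNIV. (w t $ i) *\<^sub>R \<mu> i (chart_unit K))) ?y 0 T"
    by (simp add: group_solution_def)
  then obtain D where cont: "continuous_on {0..T} ?y" and "finite D"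
    and der: "\<And>t. t \<in> {0..T} - D \<Longrightarrow> (?y has_vector_derivative
      right_translate K (\<Sum>i\<in>UNIV. (w t $ i) *\<^sub>R \<mu> i (chart_unit K)) (?y t)) (at t within {0..T})"
    by (elim pw_solutionE) (rule that)
  have "continuous_on UNIV (\<lambda>y. K y p)"
    by (intro differentiable_imp_continuous_on) (simp add: differentiable_on_def orbit_differentiable)
  from continuous_on_compose2[OF this cont] have "continuous_on {0..T} (\<lambda>t. K (?y t) p)" by simp
  then have "continuous_on {0..T} (\<lambda>t. S t p)"
    by (rule continuous_on_eq) (simp add: S)
  moreover have "((\<lambda>t. S t p) has_vector_derivative
      (\<Sum>i\<in>UNIV. (w t $ i) *\<^sub>R action_field K (\<mu> i) (S t p))) (at t within {0..T})"
    if t: "t \<in> {0..T} - D" for t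
  proof -
    obtain D' where D': "((\<lambda>y. K y p) has_derivative D') (at (?y t))"
      using orbit_differentiable[of p "?y t"] unfolding differentiable_def by (rule exE)
    have "((\<lambda>t. K (?y t) p) has_vector_derivative
        D' (right_translate K (\<Sum>i\<in>UNIV. (w t $ i) *\<^sub>R \<mu> i (chart_unit K)) (?y t))) (at t within {0..T})"
      by (rule has_vector_derivative_compose_has_derivative[OF der[OF t] D'])
    then have "((\<lambda>t. K (?y t) p) has_vector_derivative
        (\<Sum>i\<in>UNIV. (w t $ i) *\<^sub>R action_field K (\<mu> i) (S t p))) (at t within {0..T})"
      using t by (simp add: orbit_derivative_right_translate[OF D'] orbit_derivative_at_unit S)
    then show ?thesis
      by (rule has_vector_derivative_transform[rotated 2]) (use t S in auto)
  qed
  ultimately show ?thesis using \<open>finite D\<close> by (intro pw_solutionI)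
qed

(* With y t the chart coordinates of S t, the curve z t = (S t)^-1 (xi t) is constant: in
   xi t = K (y t) (z t) the first partial derivative of K already accounts for the whole
   velocity, and the second one is injective. *)
lemma group_solution_action_unique:
  assumes sol: "group_solution K \<mu> w S T"
    and \<xi>: "pw_solution (\<lambda>t q. \<Sum>i\<in>UNIV. (w t $ i) *\<^sub>R action_field K (\<mu> i) q) \<xi> 0 T"
    and t: "t \<in> {0..T}"
  shows "\<xi> t = S t (\<xi> 0)"
proof -
  let ?y = "\<lambda>t. coord K (S t)"
  let ?J = "\<lambda>y. coord K (m_inv (transformation_group H) (K y))"
  have S: "K (?y t) = S t" if "t \<in> {0..T}" for t
    using sol that chart_coord range_chart by (simp add: group_solution_def)
  have "S 0 = id" using sol by (simp add: group_solution_def)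
  from sol have "pw_solution
      (\<lambda>t. right_translate K (\<Sum>i\<in>UNIV. (w t $ i) *\<^sub>R \<mu> i (chart_unit K))) ?y 0 T"
    by (simp add: group_solution_def)
  then obtain D where cont: "continuous_on {0..T} ?y" and "finite D"
    and der: "\<And>t. t \<in> {0..T} - D \<Longrightarrow> (?y has_vector_derivative
      right_translate K (\<Sum>i\<in>UNIV. (w t $ i) *\<^sub>R \<mu> i (chart_unit K)) (?y t)) (at t within {0..T})"
    by (elim pw_solutionE) (rule that)
  from \<xi> obtain D1 where cont\<xi>: "continuous_on {0..T} \<xi>" and "finite D1"
    and der\<xi>: "\<And>t. t \<in> {0..T} - D1 \<Longrightarrow> (\<xi> has_vector_derivative
      (\<Sum>i\<in>UNIV. (w t $ i) *\<^sub>R action_field K (\<mu> i) (\<xi> t))) (at t within {0..T})"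
    by (elim pw_solutionE) (rule that)
  define z where "z = (\<lambda>t. K (?J (?y t)) (\<xi> t))"
  \<comment> \<open>\<open>chart_inverse\<close> cancels on one side only. The other side follows by
    injectivity of the inverse map.\<close>
  have Kz: "K (?y t) (z t) = \<xi> t" for t
  proof -
    have "K (?J (?y t)) (K (?y t) (z t)) = z t" by (rule chart_inverse)
    moreover have "inj (K (?J (?y t)))"
      by (rule inj_on_inverseI[where g = "K (?J (?J (?y t)))"]) (rule chart_inverse)
    ultimately show ?thesis by (metis injD z_def)
  qed
  have F: "(\<lambda>(y, q). K (?J y) q) differentiable (at (y, q))" for y q
  proof -
    have "(\<lambda>yq. ?J (fst yq)) differentiable (at (y, q))"
      by (rule differentiable_compose[of ?J fst])
         (auto intro: chart_inverse_differentiable bounded_linear_imp_differentiable bounded_linear_fst)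
    moreover have "snd differentiable (at (y, q))"
      by (intro bounded_linear_imp_differentiable bounded_linear_snd)
    ultimately have "(\<lambda>yq. (?J (fst yq), snd yq)) differentiable (at (y, q))"
      unfolding differentiable_def by (elim exE) (rule exI, rule has_derivative_Pair)
    from differentiable_compose[OF action_differentiable this]
    show ?thesis by (simp add: case_prod_beta')
  qed
  have "continuous_on UNIV (\<lambda>(y, q). K (?J y) q)"
    by (intro differentiable_imp_continuous_on) (auto simp: differentiable_on_def F)
  from continuous_on_compose2[OF this continuous_on_Pair[OF cont cont\<xi>]]
  have contz: "continuous_on {0..T} z" by (simp add: z_def)
  \<comment> \<open>The endpoints are excluded so that the derivative within the interval is unique,
    which allows the two expressions for the velocity of \<xi> to be equated.\<close>
  have derz: "(z has_derivative (\<lambda>_. 0)) (at t within {0..T})" if t: "t \<in> {0..T} - (D \<union> D1 \<union> {0, T})" for t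
  proof -
    let ?y' = "right_translate K (\<Sum>i\<in>UNIV. (w t $ i) *\<^sub>R \<mu> i (chart_unit K)) (?y t)"
    let ?\<xi>' = "\<Sum>i\<in>UNIV. (w t $ i) *\<^sub>R action_field K (\<mu> i) (\<xi> t)"
    have y': "(?y has_vector_derivative ?y') (at t within {0..T})"
      and \<xi>': "(\<xi> has_vector_derivative ?\<xi>') (at t within {0..T})"
      using der der\<xi> t by auto
    obtain E where E: "((\<lambda>(y, q). K (?J y) q) has_derivative E) (at (?y t, \<xi> t))"
      using F[of "?y t" "\<xi> t"] unfolding differentiable_def by (rule exE)
    have z': "(z has_vector_derivative E (?y', ?\<xi>')) (at t within {0..T})"
      using has_vector_derivative_compose_has_derivative[OF has_vector_derivative_Pair[OF y' \<xi>'] E]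
      by (simp add: z_def)
    obtain A where A: "((\<lambda>(y, p). K y p) has_derivative A) (at (?y t, z t))"
      using action_differentiable[of "(?y t, z t)"] unfolding differentiable_def by (rule exE)
    have "((\<lambda>t. K (?y t) (z t)) has_vector_derivative A (?y', E (?y', ?\<xi>'))) (at t within {0..T})"
      using has_vector_derivative_compose_has_derivative[OF has_vector_derivative_Pair[OF y' z'] A]
      by simp
    then have "(\<xi> has_vector_derivative A (?y', E (?y', ?\<xi>'))) (at t within {0..T})"
      by (simp add: Kz)
    moreover have "at t within {0..T} \<noteq> bot"
      using t by (simp add: at_within_Icc_at)
    ultimately have "A (?y', E (?y', ?\<xi>')) = ?\<xi>'"
      using \<xi>' vector_derivative_unique_within by blast
    moreover have "A (?y', 0) = ?\<xi>'"
      using orbit_derivative_right_translate[OF has_derivative_slice_fst[OF A]]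
      by (simp add: orbit_derivative_at_unit Kz)
    moreover have "A (?y', E (?y', ?\<xi>')) = A (?y', 0) + A (0, E (?y', ?\<xi>'))"
      using linear_add[OF has_derivative_linear[OF A], of "(?y', 0)" "(0, E (?y', ?\<xi>'))"] by simp
    ultimately have 0: "A (0, E (?y', ?\<xi>')) = 0" by simp
    \<comment> \<open>Differentiating the identity that the inverse of \<open>K (?y t)\<close>
      undoes \<open>K (?y t)\<close> makes the second partial of the inverse action a left inverse
      of the second partial \<open>A (0, _)\<close>, which is therefore injective.\<close>
    have inv: "E (0, A (0, q)) = q" for q
    proof -
      have "((\<lambda>q. K (?J (?y t)) (K (?y t) q)) has_derivative (\<lambda>q. E (0, A (0, q)))) (at (z t))"
        using has_derivative_compose[OF has_derivative_slice_snd[OF A], of "\<lambda>q. K (?J (?y t)) q"]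
          has_derivative_slice_snd[OF E] by (simp add: Kz)
      then have "((\<lambda>q. q) has_derivative (\<lambda>q. E (0, A (0, q)))) (at (z t))"
        by (simp only: chart_inverse)
      then show ?thesis using fun_cong[OF has_derivative_unique[OF _ has_derivative_ident]] by blast
    qed
    have "E (?y', ?\<xi>') = E (0, 0)"
      using inv[of "E (?y', ?\<xi>')"] unfolding 0 by (rule sym)
    also have "\<dots> = 0"
      using linear_0[OF has_derivative_linear[OF E]] by (simp add: zero_prod_def)
    finally have "E (?y', ?\<xi>') = 0" .
    then show ?thesis using z' by (simp add: has_vector_derivative_def)
  qed
  have "z t = z 0"
    by (rule has_derivative_zero_unique_strong_interval[of "D \<union> D1 \<union> {0, T}" 0 T z])
       (use \<open>finite D\<close> \<open>finite D1\<close> contz derz t in auto)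
  moreover have "z 0 = \<xi> 0" using Kz[of 0] S[of 0] t \<open>S 0 = id\<close> by simp
  ultimately show ?thesis using Kz[of t] S[OF t] by simp
qed

end

section \<open>Stability of sampled trajectories\<close>

text \<open>Choose \<delta> with \<open>\<beta> < \<alpha> \<rho>\<close> below it. A
  \<open>y\<close> outside the ball would give \<open>\<alpha> \<rho> \<le> V y \<le> V x \<le>
  \<beta> (norm x) < \<alpha> \<rho>\<close>.\<close>

lemma class_K_sublevel:
  fixes V :: "'a::real_normed_vector \<Rightarrow> real"
  assumes \<alpha>: "class_K \<alpha>" and \<beta>: "class_K \<beta>"
    and V: "\<And>x. \<alpha> (norm x) \<le> V x \<and> V x \<le> \<beta> (norm x)" and "\<rho> > 0"
  obtains \<delta> where "\<delta> > 0" "\<And>x y. norm x < \<delta> \<Longrightarrow> V y \<le> V x \<Longrightarrow> norm y < \<rho>"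
proof -
  have "\<alpha> 0 < \<alpha> \<rho>"
    using \<alpha> \<open>\<rho> > 0\<close> by (intro strict_mono_onD[of "{0..}" \<alpha>]) (auto simp: class_K_def)
  then have "0 < \<alpha> \<rho>" using \<alpha> by (simp add: class_K_def)
  moreover have "(\<beta> \<longlongrightarrow> \<beta> 0) (at 0 within {0..})"
    using \<beta> unfolding class_K_def continuous_on_def by (elim conjE) (rule bspec, assumption, simp)
  ultimately have "\<forall>\<^sub>F s in at 0 within {0..}. \<beta> s < \<alpha> \<rho>"
    using \<beta> by (intro order_tendstoD(2)) (auto simp: class_K_def)
  then obtain \<delta> where "\<delta> > 0"
    and \<delta>: "\<And>s. s \<in> {0..} \<Longrightarrow> s \<noteq> 0 \<Longrightarrow> dist s 0 < \<delta> \<Longrightarrow> \<beta> s < \<alpha> \<rho>"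
    unfolding eventually_at by blast
  show ?thesis
  proof (rule that[OF \<open>\<delta> > 0\<close>], rule ccontr)
    fix x y assume "norm x < \<delta>" "V y \<le> V x" "\<not> norm y < \<rho>"
    have "\<alpha> \<rho> \<le> \<alpha> (norm y)"
      using \<alpha> \<open>\<not> norm y < \<rho>\<close> \<open>\<rho> > 0\<close>
      by (intro strict_mono_on_leD[of "{0..}" \<alpha>]) (auto simp: class_K_def)
    also have "\<dots> \<le> \<beta> (norm x)" using V[of x] V[of y] \<open>V y \<le> V x\<close> by linarith
    also have "\<dots> < \<alpha> \<rho>"
      using \<delta>[of "norm x"] \<open>norm x < \<delta>\<close> \<open>0 < \<alpha> \<rho>\<close> \<beta> by (cases "x = 0") (auto simp: class_K_def)
    finally show False by simp
  qed
qed

text \<open>Both claims are carried through one induction: the decrease is available only inside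
  radius \<open>r\<close>, and it is the bound on \<open>V\<close> that keeps the next sample
  inside.\<close>

lemma sampled_decrease:
  fixes V :: "'a::real_normed_vector \<Rightarrow> real" and X :: "nat \<Rightarrow> 'a"
  assumes dec: "\<And>n. norm (X n) < r \<Longrightarrow> V (X (Suc n)) \<le> V (X n) - c * (norm (X n))\<^sup>2"
    and "c \<ge> 0" and \<delta>: "\<And>y. V y \<le> V (X k) \<Longrightarrow> norm y < \<rho>" and "\<rho> \<le> r"
  shows "k \<le> n \<Longrightarrow> V (X n) \<le> V (X k) \<and> norm (X n) < \<rho>"
proof (induction rule: dec_induct)
  case base
  show ?case using \<delta> by simp
next
  case (step n)
  then have "V (X (Suc n)) \<le> V (X n) - c * (norm (X n))\<^sup>2"
    using \<open>\<rho> \<le> r\<close> by (intro dec) simp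
  moreover have "0 \<le> c * (norm (X n))\<^sup>2" using \<open>c \<ge> 0\<close> by simp
  ultimately show ?case using step \<delta>[of "X (Suc n)"] by simp
qed

text \<open>Every sample outside the \<delta>-ball costs at least
  \<open>c * \<delta>\<^sup>2\<close> of \<open>V\<close>, and a nonnegative \<open>V\<close> cannot
  pay this \<open>N\<close> times.\<close>

lemma sampled_reaches_ball:
  fixes V :: "'a::real_normed_vector \<Rightarrow> real" and X :: "nat \<Rightarrow> 'a"
  assumes dec: "\<And>n. V (X (Suc n)) \<le> V (X n) - c * (norm (X n))\<^sup>2"
    and V: "\<And>x. V x \<ge> 0" and "c > 0" "\<delta> > 0" and N: "V (X 0) < real N * (c * \<delta>\<^sup>2)"
  shows "\<exists>k\<le>N. norm (X k) < \<delta>"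
proof (rule ccontr)
  assume far: "\<not> (\<exists>k\<le>N. norm (X k) < \<delta>)"
  have "k \<le> N \<Longrightarrow> V (X k) \<le> V (X 0) - real k * (c * \<delta>\<^sup>2)" for k
  proof (induction k)
    case (Suc k)
    have "c * \<delta>\<^sup>2 \<le> c * (norm (X k))\<^sup>2"
      using far Suc.prems \<open>c > 0\<close> \<open>\<delta> > 0\<close> by (intro mult_left_mono power_mono) (auto simp: not_less)
    then show ?case using Suc dec[of k] by (simp add: algebra_simps)
  qed simp
  from this[of N] show False using V[of "X N"] N by simp
qed

text \<open>The constants in \<open>dec\<close> and \<open>inter\<close> do not involve
  \<open>t0\<close>, which makes stability and convergence uniform.\<close>

lemma sampled_uniformly_asymptotically_stable:
  fixes traj :: "real \<Rightarrow> (real \<Rightarrow> 'a::real_normed_vector) \<Rightarrow> bool" and V :: "'a \<Rightarrow> real"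
  assumes \<alpha>: "class_K \<alpha>" and \<beta>: "class_K \<beta>"
    and V_bounds: "\<And>x. \<alpha> (norm x) \<le> V x \<and> V x \<le> \<beta> (norm x)" and V_nonneg: "\<And>x. V x \<ge> 0"
    and "T > 0" "c > 0" "\<kappa> \<ge> 0" "r > 0"
    and existence: "\<exists>\<delta>>0. \<forall>t0\<ge>0. \<forall>x0. norm x0 < \<delta> \<longrightarrow> (\<exists>x. traj t0 x \<and> x t0 = x0)"
    and dec: "\<And>t0 x n. t0 \<ge> 0 \<Longrightarrow> traj t0 x \<Longrightarrow> norm (x (t0 + real n * T)) < r \<Longrightarrow>
      V (x (t0 + real (Suc n) * T)) \<le> V (x (t0 + real n * T)) - c * (norm (x (t0 + real n * T)))\<^sup>2"
    and inter: "\<And>t0 x n \<tau>. t0 \<ge> 0 \<Longrightarrow> traj t0 x \<Longrightarrow> norm (x (t0 + real n * T)) < r \<Longrightarrow>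
      \<tau> \<in> {0..T} \<Longrightarrow> norm (x (t0 + real n * T + \<tau>)) \<le> \<kappa> * norm (x (t0 + real n * T))"
  shows "uniformly_asymptotically_stable traj"
proof -
  \<comment> \<open>Stated from an arbitrary sampling instant: \<open>k = 0\<close> is uniform
    stability, and convergence restarts it at the sample that has entered the \<delta>-ball.\<close>
  have stay: "\<exists>\<delta>>0. \<forall>t0\<ge>0. \<forall>x k. traj t0 x \<and> norm (x (t0 + real k * T)) < \<delta> \<longrightarrow>
      (\<forall>t\<ge>t0 + real k * T. norm (x t) < \<rho>)" if "\<rho> > 0" for \<rho>
  proof -
    \<comment> \<open>The bound by \<open>r\<close> makes \<open>dec\<close> and
      \<open>inter\<close> applicable; the quotient leaves room for the factor \<kappa> between
      samples, strictly and also for \<kappa> = 0.\<close>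
    define \<rho>' where "\<rho>' = min r (\<rho> / (\<kappa> + 1))"
    have "\<rho>' > 0" "\<rho>' \<le> r" using that \<open>r > 0\<close> \<open>\<kappa> \<ge> 0\<close> by (auto simp: \<rho>'_def)
    have "\<kappa> * \<rho>' \<le> \<kappa> * (\<rho> / (\<kappa> + 1))"
      using \<open>\<kappa> \<ge> 0\<close> by (intro mult_left_mono) (auto simp: \<rho>'_def)
    also have "\<dots> < \<rho>" using that \<open>\<kappa> \<ge> 0\<close> by (simp add: divide_less_eq)
    finally have \<kappa>\<rho>': "\<kappa> * \<rho>' < \<rho>" .
    obtain \<delta> where "\<delta> > 0" and \<delta>: "\<And>x y. norm x < \<delta> \<Longrightarrow> V y \<le> V x \<Longrightarrow> norm y < \<rho>'"
      using class_K_sublevel[OF \<alpha> \<beta> V_bounds \<open>\<rho>' > 0\<close>] by blast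
    have "norm (x t) < \<rho>"
      if "t0 \<ge> 0" and x: "traj t0 x" "norm (x (t0 + real k * T)) < \<delta>" and t: "t \<ge> t0 + real k * T"
      for t0 x k t
    proof -
      define n where "n = nat \<lfloor>(t - t0) / T\<rfloor>"
      define \<tau> where "\<tau> = t - (t0 + real n * T)"
      have "real k \<le> (t - t0) / T" using t \<open>T > 0\<close> by (simp add: pos_le_divide_eq)
      then have "int k \<le> \<lfloor>(t - t0) / T\<rfloor>" by (simp add: le_floor_iff)
      then have "k \<le> n" and n: "real n = real_of_int \<lfloor>(t - t0) / T\<rfloor>" by (auto simp: n_def)
      have "real n \<le> (t - t0) / T" "(t - t0) / T < real n + 1" unfolding n by linarith+
      then have "\<tau> \<in> {0..T}"
        using \<open>T > 0\<close> by (auto simp: \<tau>_def pos_le_divide_eq pos_divide_less_eq algebra_simps)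
      have "norm (x (t0 + real n * T)) < \<rho>'"
        using sampled_decrease[of "\<lambda>n. x (t0 + real n * T)" r V c k \<rho>' n] dec[OF \<open>t0 \<ge> 0\<close> x(1)]
          \<delta>[OF x(2)] \<open>c > 0\<close> \<open>\<rho>' \<le> r\<close> \<open>k \<le> n\<close> by simp
      then have "norm (x (t0 + real n * T + \<tau>)) \<le> \<kappa> * \<rho>'"
        using inter[OF \<open>t0 \<ge> 0\<close> x(1), of n \<tau>] \<open>\<tau> \<in> {0..T}\<close> \<open>\<rho>' \<le> r\<close> \<open>\<kappa> \<ge> 0\<close>
          mult_left_mono[of "norm (x (t0 + real n * T))" \<rho>' \<kappa>] by simp
      then show ?thesis using \<kappa>\<rho>' by (simp add: \<tau>_def)
    qed
    then show ?thesis using \<open>\<delta> > 0\<close> by blast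
  qed
  obtain \<delta>r where "\<delta>r > 0" and \<delta>r: "\<And>x y. norm x < \<delta>r \<Longrightarrow> V y \<le> V x \<Longrightarrow> norm y < r"
    using class_K_sublevel[OF \<alpha> \<beta> V_bounds \<open>r > 0\<close>] by blast
  have attract: "\<exists>\<theta>\<ge>0. \<forall>t0\<ge>0. \<forall>x. traj t0 x \<and> x t0 = x0 \<longrightarrow> (\<forall>t\<ge>t0 + \<theta>. norm (x t) < \<rho>)"
    if x0: "norm x0 < \<delta>r" and "\<rho> > 0" for x0 \<rho>
  proof -
    obtain \<delta> where "\<delta> > 0" and \<delta>: "\<And>t0 x k t. t0 \<ge> 0 \<Longrightarrow> traj t0 x \<Longrightarrow>
        norm (x (t0 + real k * T)) < \<delta> \<Longrightarrow> t \<ge> t0 + real k * T \<Longrightarrow> norm (x t) < \<rho>"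
      using stay[OF \<open>\<rho> > 0\<close>] by blast
    have "c * \<delta>\<^sup>2 > 0" using \<open>c > 0\<close> \<open>\<delta> > 0\<close> by simp
    \<comment> \<open>The number of periods depends on \<open>x0\<close> and, through \<delta>, on
      \<rho>, but not on \<open>t0\<close>; the settling time is \<open>N * T\<close>.\<close>
    then obtain N where N: "V x0 < real N * (c * \<delta>\<^sup>2)" using reals_Archimedean3 by blast
    have "norm (x t) < \<rho>" if "t0 \<ge> 0" "traj t0 x" "x t0 = x0" "t \<ge> t0 + real N * T" for t0 x t
    proof -
      let ?X = "\<lambda>n. x (t0 + real n * T)"
      have "norm (?X n) < r" for n
        using sampled_decrease[of ?X r V c 0 r n] dec[OF that(1,2)] \<delta>r[OF x0] \<open>c > 0\<close> that(3) by simp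
      then have "\<exists>k\<le>N. norm (?X k) < \<delta>"
        using that(3) by (intro sampled_reaches_ball[of V ?X c, OF dec[OF that(1,2)] V_nonneg \<open>c > 0\<close> \<open>\<delta> > 0\<close>])
          (auto simp: N)
      then obtain k where "k \<le> N" "norm (?X k) < \<delta>" by blast
      moreover have "real k * T \<le> real N * T" using \<open>k \<le> N\<close> \<open>T > 0\<close> by simp
      ultimately show ?thesis using \<delta>[OF that(1,2)] that(4) by force
    qed
    then show ?thesis using \<open>T > 0\<close> by (intro exI[of _ "real N * T"]) auto
  qed
  have "\<exists>\<delta>>0. \<forall>t0\<ge>0. \<forall>x. traj t0 x \<and> norm (x t0) < \<delta> \<longrightarrow> (\<forall>t\<ge>t0. norm (x t) < \<rho>)"
    if "\<rho> > 0" for \<rho>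
  proof -
    obtain \<delta> where "\<delta> > 0" and \<delta>: "\<forall>t0\<ge>0. \<forall>x k. traj t0 x \<and> norm (x (t0 + real k * T)) < \<delta> \<longrightarrow>
        (\<forall>t\<ge>t0 + real k * T. norm (x t) < \<rho>)"
      using stay[OF \<open>\<rho> > 0\<close>] by blast
    show ?thesis
    proof (intro exI[of _ \<delta>] conjI allI impI)
      fix t0 x t assume "t0 \<ge> 0" "traj t0 x \<and> norm (x t0) < \<delta>" "t \<ge> t0"
      then show "norm (x t) < \<rho>" using \<delta>[rule_format, of t0 x 0 t] by simp
    qed fact
  qed
  moreover have "\<exists>N. open N \<and> 0 \<in> N \<and> (\<forall>x0\<in>N. \<forall>\<rho>>0. \<exists>\<theta>\<ge>0. \<forall>t0\<ge>0. \<forall>x.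
      traj t0 x \<and> x t0 = x0 \<longrightarrow> (\<forall>t\<ge>t0 + \<theta>. norm (x t) < \<rho>))"
    using attract \<open>\<delta>r > 0\<close> by (intro exI[of _ "ball 0 \<delta>r"]) auto
  ultimately show ?thesis using existence unfolding uniformly_asymptotically_stable_def by blast
qed

section \<open>The closed loop as a concatenation\<close>

lemma floor_sample_index:
  fixes t t0 T :: real
  assumes "T > 0" "t0 + real n * T \<le> t" "t < t0 + real (Suc n) * T"
  shows "\<lfloor>(t - t0) / T\<rfloor> = int n"
proof -
  have "real n \<le> (t - t0) / T" using assms by (simp add: pos_le_divide_eq)
  moreover have "(t - t0) / T < real (Suc n)"
    using assms by (simp add: pos_divide_less_eq algebra_simps)
  ultimately show ?thesis by (intro floor_unique) auto
qed

lemma concat_control_eq: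
  assumes "T > 0" "t0 + real n * T \<le> t" "t < t0 + real (Suc n) * T"
  shows "concat_control ubar T t0 x t = ubar (x (t0 + real n * T)) (t - (t0 + real n * T))"
  by (simp add: concat_control_def Let_def floor_sample_index[OF assms])

lemma closed_loop_sampling_interval:
  assumes "closed_loop f ubar T t0 x" "T > 0"
  shows "pw_solution (\<lambda>\<tau>. affine_field f (ubar (x (t0 + real n * T)) \<tau>))
    (\<lambda>\<tau>. x (t0 + real n * T + \<tau>)) 0 T"
proof -
  let ?a = "t0 + real n * T" and ?b = "t0 + real (Suc n) * T"
  have "t0 \<le> ?b" using \<open>T > 0\<close> by simp
  then have "pw_solution (\<lambda>t. affine_field f (concat_control ubar T t0 x t)) x t0 ?b"
    using assms(1) by (simp add: closed_loop_def closed_loop_until_def)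
  then have "pw_solution (\<lambda>t. affine_field f (concat_control ubar T t0 x t)) x ?a ?b"
    by (rule pw_solution_subset) (use \<open>T > 0\<close> in auto)
  then have "pw_solution (\<lambda>t. affine_field f (ubar (x ?a) (t - ?a))) x ?a ?b"
    \<comment> \<open>At \<open>?b\<close> the floor has already jumped to the next index, so this
      one instant is exempted.\<close>
    by (rule pw_solution_cong[where E = "{?b}"])
      (use \<open>T > 0\<close> in \<open>auto simp: concat_control_eq[symmetric]\<close>)
  from pw_solution_shift[OF this, of ?a] show ?thesis
    by (simp add: algebra_simps)
qed

text \<open>\<open>P\<close> is an invariant set for the samples: from each of its points one period
  can be solved and ends in \<open>P\<close> again. Gluing such periods gives a trajectory for all
  later times.\<close>

lemma closed_loop_exists:
  fixes f :: "'i::finite option \<Rightarrow> real ^ 'n \<Rightarrow> real ^ 'n"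
  assumes "T > 0" and "x0 \<in> P"
    and step: "\<And>p. p \<in> P \<Longrightarrow>
      \<exists>\<xi>. \<xi> 0 = p \<and> \<xi> T \<in> P \<and> pw_solution (\<lambda>\<tau>. affine_field f (ubar p \<tau>)) \<xi> 0 T"
  shows "\<exists>x. closed_loop f ubar T t0 x \<and> x t0 = x0"
proof -
  obtain \<Xi> where \<Xi>: "\<And>p. p \<in> P \<Longrightarrow> \<Xi> p 0 = p \<and> \<Xi> p T \<in> P \<and>
      pw_solution (\<lambda>\<tau>. affine_field f (ubar p \<tau>)) (\<Xi> p) 0 T"
    using bchoice[of P "\<lambda>p \<xi>. \<xi> 0 = p \<and> \<xi> T \<in> P \<and> pw_solution (\<lambda>\<tau>. affine_field f (ubar p \<tau>)) \<xi> 0 T"]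
      step by blast
  define X where "X = rec_nat x0 (\<lambda>_ p. \<Xi> p T)"
  have X_Suc: "X (Suc n) = \<Xi> (X n) T" for n by (simp add: X_def)
  have XP: "X n \<in> P" for n
    by (induction n) (use \<open>x0 \<in> P\<close> \<Xi> in \<open>auto simp: X_def\<close>)
  define a where "a n = t0 + real n * T" for n
  define x where "x t = (let n = nat \<lfloor>(t - t0) / T\<rfloor> in \<Xi> (X n) (t - a n))" for t
  have x_less: "x t = \<Xi> (X n) (t - a n)" if "a n \<le> t" "t < a (Suc n)" for n t
    using floor_sample_index[OF \<open>T > 0\<close>, of t0 n t] that by (simp add: x_def a_def)
  have xa: "x (a n) = X n" for n
    using x_less[of n "a n"] \<open>T > 0\<close> \<Xi>[OF XP] by (simp add: a_def)
  \<comment> \<open>At the right endpoint the definition selects the next piece, which starts at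
    \<open>X (Suc n)\<close>, the end of the current one. Hence the formula holds on the closed
    interval.\<close>
  have x_le: "x t = \<Xi> (X n) (t - a n)" if "t \<in> {a n..a (Suc n)}" for n t
  proof (cases "t = a (Suc n)")
    case True
    then show ?thesis using xa[of "Suc n"] by (simp add: X_Suc) (simp add: a_def algebra_simps)
  qed (use that in \<open>auto intro: x_less\<close>)
  let ?G = "\<lambda>t. affine_field f (concat_control ubar T t0 x t)"
  have piece: "pw_solution ?G x (a n) (a (Suc n))" for n
  proof (rule pw_solution_cong[where E = "{a (Suc n)}"])
    have "0 + a n = a n" "T + a n = a (Suc n)" by (auto simp: a_def algebra_simps)
    then show "pw_solution (\<lambda>t. affine_field f (ubar (X n) (t - a n))) (\<lambda>t. \<Xi> (X n) (t - a n)) (a n) (a (Suc n))"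
      using \<Xi>[OF XP, of n] pw_solution_shift[of "\<lambda>\<tau>. affine_field f (ubar (X n) \<tau>)" "\<Xi> (X n)" 0 T "- a n"]
      by simp
    fix t assume "t \<in> {a n..a (Suc n)} - {a (Suc n)}"
    then show "?G t (\<Xi> (X n) (t - a n)) = affine_field f (ubar (X n) (t - a n)) (\<Xi> (X n) (t - a n))"
      using concat_control_eq[OF \<open>T > 0\<close>, of t0 n t ubar x] xa[of n] by (auto simp: a_def)
  qed (use x_le in auto)
  have upto: "pw_solution ?G x t0 (a n)" for n
  proof (induction n)
    case (Suc n)
    then show ?case
      by (rule pw_solution_join[OF _ piece]) (use \<open>T > 0\<close> in \<open>auto simp: a_def\<close>)
  qed (simp add: a_def pw_solution_refl)
  have "closed_loop f ubar T t0 x"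
    unfolding closed_loop_def closed_loop_until_def
  proof (intro allI impI)
    fix b assume "b \<ge> t0"
    obtain n where "b - t0 < real n * T" using reals_Archimedean3[OF \<open>T > 0\<close>] by blast
    then show "pw_solution ?G x t0 b"
      by (intro pw_solution_subset[OF upto[of n]]) (auto simp: a_def)
  qed
  moreover have "x t0 = x0" using xa[of 0] by (simp add: a_def X_def)
  ultimately show ?thesis by blast
qed

section \<open>Solutions of the satisficing problem\<close>

lemma sum_UNIV_option: "(\<Sum>i\<in>UNIV. h i) = h None + (\<Sum>i\<in>UNIV. h (Some i))"
  for h :: "'i::finite option \<Rightarrow> 'b::comm_monoid_add"
  by (simp add: UNIV_option_conv sum.reindex)

lemma sum_UNIV_sum: "(\<Sum>i\<in>UNIV. h i) = (\<Sum>i\<in>UNIV. h (Inl i)) + (\<Sum>i\<in>UNIV. h (Inr i))"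
  for h :: "'i::finite + 'j::finite \<Rightarrow> 'b::comm_monoid_add"
  by (simp add: UNIV_Plus_UNIV[symmetric] sum.Plus del: UNIV_Plus_UNIV)

lemma affine_field_embed_v: "(\<Sum>i\<in>UNIV. (embed_v v $ i) *\<^sub>R g i q) = affine_field g v q"
  by (simp add: sum_UNIV_option affine_field_def embed_v_def)

lemma affine_field_embed_u:
  assumes "g None = f None" "\<And>i. g (Some (Inl i)) = f (Some i)"
  shows "(\<Sum>i\<in>UNIV. (embed_u u $ i) *\<^sub>R g i q) = affine_field f u q"
  by (simp add: sum_UNIV_option sum_UNIV_sum affine_field_def embed_u_def assms)

(* The endpoint S T is shared by the original and the extended system on the group. *)
lemma satisficing_solution_flow:
  assumes group: "analytic_transformation_group H K"
    and \<mu>: "\<And>i. action_field K (\<mu> i) = g i"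
    and g: "g None = f None" "\<And>i. g (Some (Inl i)) = f (Some i)"
    and sol: "satisficing_solution K \<mu> \<psi> T U s w"
  obtains S where "S 0 = id"
    and "\<And>p. pw_solution (\<lambda>\<tau>. affine_field f (step_control T s w \<tau>)) (\<lambda>\<tau>. S \<tau> p) 0 T"
    and "\<And>p. S T p \<in> reach_ext g T p U"
    and "\<And>\<xi> t. pw_solution (\<lambda>\<tau>. affine_field f (step_control T s w \<tau>)) \<xi> 0 T \<Longrightarrow>
      t \<in> {0..T} \<Longrightarrow> \<xi> t = S t (\<xi> 0)"
proof -
  obtain G v where "v \<in> U" and G: "gamma_at K \<mu> \<psi> T (\<lambda>_. embed_v v) G"
    and G': "gamma_at K \<mu> \<psi> T (\<lambda>\<tau>. embed_u (step_control T s w \<tau>)) G"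
    using sol unfolding satisficing_solution_def reach_gamma_def by blast
  obtain Se where Se: "group_solution K \<mu> (\<lambda>_. embed_v v) Se T" "Se T = exp_product K \<psi> G"
    using G unfolding gamma_at_def by blast
  obtain S where S: "group_solution K \<mu> (\<lambda>\<tau>. embed_u (step_control T s w \<tau>)) S T"
      "S T = exp_product K \<psi> G"
    using G' unfolding gamma_at_def by blast
  have u: "(\<Sum>i\<in>UNIV. (embed_u (step_control T s w t) $ i) *\<^sub>R action_field K (\<mu> i) q)
      = affine_field f (step_control T s w t) q" for t q
    unfolding \<mu> by (rule affine_field_embed_u[OF g])
  have v: "(\<Sum>i\<in>UNIV. (embed_v v $ i) *\<^sub>R action_field K (\<mu> i) q) = affine_field g v q" for q
    unfolding \<mu> by (rule affine_field_embed_v)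
  show ?thesis
  proof
    show "S 0 = id" using S by (simp add: group_solution_def)
    show "pw_solution (\<lambda>\<tau>. affine_field f (step_control T s w \<tau>)) (\<lambda>\<tau>. S \<tau> p) 0 T" for p
      using group_solution_action[OF group S(1), of p] unfolding u .
    show "S T p \<in> reach_ext g T p U" for p
    proof -
      have "pw_solution (\<lambda>_. affine_field g v) (\<lambda>\<tau>. Se \<tau> p) 0 T"
        using group_solution_action[OF group Se(1), of p] unfolding v .
      moreover have "Se 0 p = p" using Se(1) by (simp add: group_solution_def)
      \<comment> \<open>Equal \<gamma>-coordinates mean equal group elements, so
        \<open>S T p\<close> is also the endpoint of the extended trajectory of \<open>p\<close>
        under the constant control \<open>v\<close>.\<close>
      ultimately show ?thesis
        unfolding reach_ext_def S(2) Se(2)[symmetric]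
        using \<open>v \<in> U\<close> by (intro CollectI exI[of _ "\<lambda>\<tau>. Se \<tau> p"] exI[of _ v]) simp
    qed
    show "\<xi> t = S t (\<xi> 0)"
      if "pw_solution (\<lambda>\<tau>. affine_field f (step_control T s w \<tau>)) \<xi> 0 T" "t \<in> {0..T}" for \<xi> t
      using group_solution_action_unique[OF group S(1) _ that(2), of \<xi>] that(1) unfolding u by blast
  qed
qed

section \<open>Uniform asymptotic stability of the closed loop\<close>

theorem theorem2:
  fixes f :: "'m::{finite,linorder} option \<Rightarrow> real ^ 'n \<Rightarrow> real ^ 'n"
    and g :: "('m + 'k::{finite,linorder}) option \<Rightarrow> real ^ 'n \<Rightarrow> real ^ 'n"
    and V :: "real ^ 'n \<Rightarrow> real"
    and \<alpha> \<beta> :: "real \<Rightarrow> real"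
    and H :: "(real ^ 'n \<Rightarrow> real ^ 'n) set"
    and K :: "real ^ ('m + 'k) option \<Rightarrow> real ^ 'n \<Rightarrow> real ^ 'n"
    and \<mu> \<psi> :: "('m + 'k) option \<Rightarrow> real ^ ('m + 'k) option \<Rightarrow> real ^ ('m + 'k) option"
    and R \<eta> M \<zeta> T Tmax C :: real
    and s :: "real ^ 'n \<Rightarrow> nat"
    and w :: "real ^ 'n \<Rightarrow> nat \<Rightarrow> real ^ 'm::{finite,linorder}"
    and ubar :: "real ^ 'n \<Rightarrow> real \<Rightarrow> real ^ 'm::{finite,linorder}"
  assumes m_less_n: "CARD('m) < CARD('n)"
    and f_analytic: "\<And>i. real_analytic (f i)"
    and f_complete: "\<And>i. complete_field (f i)"
    and f_independent: "independent_family f"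
    and f_drift: "f None 0 = 0"
    and f_nilpotent: "nilpotent_lie_algebra (lie_generated (range f))"
    and L_dim: "dim (lie_generated (range f)) = CARD(('m + 'k) option)"
    and r_ge: "CARD(('m + 'k) option) \<ge> CARD('n) + 1"
    and f_controllable: "strongly_controllable f"
    and V_nonneg: "\<And>x. V x \<ge> 0"
    and V_C2: "twice_continuously_differentiable V"
    and V_zero: "V 0 = 0"
    and \<zeta>_pos: "\<zeta> > 0"
    and V_gradient: "\<And>x. norm (gradient V x) \<ge> \<zeta> * norm x"
    and \<alpha>_K: "class_K \<alpha>"
    and \<beta>_K: "class_K \<beta>"
    and V_bounds: "\<And>x. \<alpha> (norm x) \<le> V x \<and> V x \<le> \<beta> (norm x)"
    and R_pos: "R > 0"
    and \<eta>_pos: "\<eta> > 0"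
    and M_pos: "M > 0"
    and g_basis: "family_basis g (lie_generated (range f))"
    and g_drift: "g None = f None"
    and g_control: "\<And>i. g (Some (Inl i)) = f (Some i)"
    and g_brackets: "\<And>j. g (Some (Inr j)) \<in> iterated_brackets (range f)"
    and g_spanning: "\<And>x. x \<in> ball 0 R \<Longrightarrow>
      \<exists>B \<subseteq> range (\<lambda>i. g (Some i) x). independent B \<and> span B = lie_eval (range f) x"
    and full_rank: "\<And>x. x \<in> ball 0 R \<Longrightarrow> lie_eval (range f) x = UNIV"
    and H_group: "analytic_transformation_group H K"
    and H_nilpotent: "nilpotent_group (transformation_group H)"
    and H_iso: "lie_isomorphism (action_field K) (right_invariant_fields K) (lie_generated (range f))"
    and \<mu>_mem: "\<And>i. \<mu> i \<in> right_invariant_fields K"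
    and \<mu>_action: "\<And>i. action_field K (\<mu> i) = g i"
    and \<psi>_basis: "family_basis \<psi> (right_invariant_fields K)"
    and \<psi>_drift: "\<psi> None = \<mu> None"
    and \<psi>_control: "\<And>i. \<psi> (Some (Inl i)) = \<mu> (Some (Inl i))"
    and \<psi>_chart: "global_chart H K (exp_product K \<psi>)"
    \<comment> \<open>the state 0 is excluded because U_ext g V \<eta> M 0 is empty there\<close>
    and SP_solvable: "\<And>x T'. x \<in> ball 0 R - {0} \<Longrightarrow> T' > 0 \<Longrightarrow>
      \<exists>s w. satisficing_solution K \<mu> \<psi> T' (U_ext g V \<eta> M x) s w"
    and Tmax_pos: "Tmax > 0"
    and Tmax_decrease: "\<And>T' x z. 0 \<le> T' \<Longrightarrow> T' \<le> Tmax \<Longrightarrow> x \<in> ball 0 R \<Longrightarrow>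
      z \<in> reach_ext g T' x (U_ext g V \<eta> M x) \<Longrightarrow> V z - V x \<le> - (\<eta> / 2) * (norm x)\<^sup>2 * T'"
    and T_pos: "0 < T"
    and T_le: "T \<le> Tmax"
    and SP_solutions: "\<And>x. x \<in> ball 0 R - {0} \<Longrightarrow>
      satisficing_solution K \<mu> \<psi> T (U_ext g V \<eta> M x) (s x) (w x)"
    and ubar_eq: "\<And>x \<tau>. ubar x \<tau> = step_control T (s x) (w x) \<tau>"
    and C_pos: "C > 0"
    and ubar_bound: "\<And>t0 n x \<tau>. t0 \<ge> 0 \<Longrightarrow> closed_loop_until f ubar T t0 (t0 + real n * T) x \<Longrightarrow>
      x (t0 + real n * T) \<in> ball 0 R \<Longrightarrow> 0 \<le> \<tau> \<Longrightarrow> \<tau> \<le> T \<Longrightarrow>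
      norm (ubar (x (t0 + real n * T)) \<tau>) \<le> C * norm (x (t0 + real n * T))"
  shows "uniformly_asymptotically_stable (closed_loop f ubar T)"
proof -
  let ?U = "\<lambda>p. U_ext g V \<eta> M p"
  \<comment> \<open>The bound is assumed along closed-loop trajectories. On the degenerate interval
    from 0 to 0 the constant curve \<open>p\<close> is one, so the bound holds at every state of the
    ball.\<close>
  have ubar_bound': "norm (ubar p \<tau>) \<le> C * norm p" if "norm p < R" "\<tau> \<in> {0..T}" for p \<tau>
    using ubar_bound[of 0 0 "\<lambda>_. p" \<tau>] that
    by (simp add: closed_loop_until_def pw_solution_refl)
  \<comment> \<open>\<open>S\<close> acts on all states, but the decrease of \<open>V\<close>
    concerns \<open>p\<close> alone, as the control is computed for \<open>p\<close>. The last
    conjunct is uniqueness, which transfers the decrease to actual trajectories.\<close>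
  have flow: "\<exists>S. S 0 = id \<and> (\<forall>q. pw_solution (\<lambda>\<tau>. affine_field f (ubar p \<tau>)) (\<lambda>\<tau>. S \<tau> q) 0 T) \<and>
      V (S T p) \<le> V p - \<eta> / 2 * T * (norm p)\<^sup>2 \<and>
      (\<forall>\<xi> t. pw_solution (\<lambda>\<tau>. affine_field f (ubar p \<tau>)) \<xi> 0 T \<longrightarrow> t \<in> {0..T} \<longrightarrow> \<xi> t = S t (\<xi> 0))"
    if p: "norm p < R" "p \<noteq> 0" for p
  proof -
    have "satisficing_solution K \<mu> \<psi> T (?U p) (s p) (w p)" using p by (intro SP_solutions) auto
    then obtain S where S: "S 0 = id"
      "\<And>q. pw_solution (\<lambda>\<tau>. affine_field f (step_control T (s p) (w p) \<tau>)) (\<lambda>\<tau>. S \<tau> q) 0 T"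
      "\<And>q. S T q \<in> reach_ext g T q (?U p)"
      "\<And>\<xi> t. pw_solution (\<lambda>\<tau>. affine_field f (step_control T (s p) (w p) \<tau>)) \<xi> 0 T \<Longrightarrow>
        t \<in> {0..T} \<Longrightarrow> \<xi> t = S t (\<xi> 0)"
      by (rule satisficing_solution_flow[where f = f and g = g, OF H_group \<mu>_action g_drift g_control]) blast
    have "V (S T p) - V p \<le> - (\<eta> / 2) * (norm p)\<^sup>2 * T"
      using Tmax_decrease[OF _ T_le _ S(3)] T_pos p by simp
    then have "V (S T p) \<le> V p - \<eta> / 2 * T * (norm p)\<^sup>2" by (simp add: mult_ac)
    then show ?thesis using S by (intro exI[of _ S]) (simp add: ubar_eq)
  qed
  have f_diff: "f i differentiable (at q)" for i q
    by (rule real_analytic_imp_differentiable[OF f_analytic])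
  obtain r0 L B where "r0 > 0" "L \<ge> 0" "B \<ge> 0"
    and f_bound: "\<And>u q. norm q \<le> r0 \<Longrightarrow> norm (affine_field f u q) \<le> L * norm q + B * norm u"
    using affine_field_local_bound[of f, OF f_diff f_drift] f_diff differentiable_imp_continuous_within
    by metis
  \<comment> \<open>The growth constant for \<open>c = B * C\<close>: during a period the control
    term is at most \<open>B * C\<close> times the norm of the sampled state.\<close>
  define \<kappa> where "\<kappa> = sqrt (2 * exp ((2 * L + B * C) * T))"
  have "\<kappa> \<ge> 0" by (simp add: \<kappa>_def)
  \<comment> \<open>\<open>R\<close> is needed for the control bound and the satisficing solutions;
    the quotient keeps \<kappa> times the sampled norm below \<open>r0\<close>, where the field
    estimate holds.\<close>
  define r where "r = min R (r0 / (\<kappa> + 1))"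
  have "r > 0" "r \<le> R" using R_pos \<open>r0 > 0\<close> \<open>\<kappa> \<ge> 0\<close> by (auto simp: r_def)
  have growth: "norm (\<xi> t) \<le> \<kappa> * norm (\<xi> 0)"
    if "norm (\<xi> 0) < r" and "pw_solution (\<lambda>\<tau>. affine_field f (ubar (\<xi> 0) \<tau>)) \<xi> 0 T" and "t \<in> {0..T}" for \<xi> t
    unfolding \<kappa>_def
  proof (rule pw_solution_growth[OF that(2) \<open>L \<ge> 0\<close> _ _ _ that(3), where r = r0])
    show "0 \<le> B * C" using \<open>B \<ge> 0\<close> C_pos by simp
    have "norm (\<xi> 0) < r0 / (\<kappa> + 1)" using that(1) by (simp add: r_def)
    then have "(\<kappa> + 1) * norm (\<xi> 0) < r0"
      using \<open>\<kappa> \<ge> 0\<close> by (simp add: pos_less_divide_eq mult.commute)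
    then have "\<kappa> * norm (\<xi> 0) < r0" 
      using norm_ge_zero[of "\<xi> 0"] unfolding distrib_right by linarith
    then show "sqrt (2 * exp ((2 * L + B * C) * T)) * norm (\<xi> 0) < r0" by (simp add: \<kappa>_def)
    fix \<tau> :: real and q :: "real ^ 'n" assume "\<tau> \<in> {0..T}" "norm q \<le> r0"
    then have "norm (affine_field f (ubar (\<xi> 0) \<tau>) q) \<le> L * norm q + B * norm (ubar (\<xi> 0) \<tau>)"
      by (intro f_bound)
    also have "\<dots> \<le> L * norm q + B * (C * norm (\<xi> 0))"
      using ubar_bound'[of "\<xi> 0" \<tau>] that(1) \<open>r \<le> R\<close> \<open>\<tau> \<in> {0..T}\<close> \<open>B \<ge> 0\<close>
      by (intro add_left_mono mult_left_mono) auto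
    finally show "norm (affine_field f (ubar (\<xi> 0) \<tau>) q) \<le> L * norm q + B * C * norm (\<xi> 0)"
      by (simp add: mult.assoc)
  qed
  show ?thesis
  proof (rule sampled_uniformly_asymptotically_stable[OF \<alpha>_K \<beta>_K V_bounds V_nonneg T_pos _ \<open>\<kappa> \<ge> 0\<close> \<open>r > 0\<close>])
    show "\<eta> / 2 * T > 0" using \<eta>_pos T_pos by simp
  next
    \<comment> \<open>The sublevel set of \<open>V x0\<close> then lies in the ball of radius
      \<open>R\<close>. As \<open>V\<close> does not increase over a period, it serves as the
      invariant set \<open>P\<close>.\<close>
    obtain \<delta> where "\<delta> > 0" and \<delta>: "\<And>x y. norm x < \<delta> \<Longrightarrow> V y \<le> V x \<Longrightarrow> norm y < R"
      using class_K_sublevel[OF \<alpha>_K \<beta>_K V_bounds R_pos] by blast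
    have "\<exists>x. closed_loop f ubar T t0 x \<and> x t0 = x0" if x0: "norm x0 < \<delta>" for t0 x0
    proof (rule closed_loop_exists[OF T_pos, of x0 "{p. V p \<le> V x0}"])
      fix p assume "p \<in> {p. V p \<le> V x0}"
      then have "V p \<le> V x0" and p: "norm p < R" using \<delta>[OF x0] by auto
      show "\<exists>\<xi>. \<xi> 0 = p \<and> \<xi> T \<in> {p. V p \<le> V x0} \<and> pw_solution (\<lambda>\<tau>. affine_field f (ubar p \<tau>)) \<xi> 0 T"
      \<comment> \<open>No satisficing solution is available at 0. There the control bound forces
        zero control, and the vanishing drift makes the constant curve a solution.\<close>
      proof (cases "p = 0")
        case True
        have "affine_field f (ubar 0 t) 0 = 0" if "t \<in> {0..T}" for t
          using ubar_bound'[of 0 t] R_pos that f_drift by (simp add: affine_field_def)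
        then have "pw_solution (\<lambda>\<tau>. affine_field f (ubar p \<tau>)) (\<lambda>_. 0) 0 T"
          using True by (intro pw_solutionI[where D = "{}"]) auto
        then show ?thesis using True \<open>V p \<le> V x0\<close> by (intro exI[of _ "\<lambda>_. 0"]) simp
      next
        case False
        obtain S where "S 0 = id" "pw_solution (\<lambda>\<tau>. affine_field f (ubar p \<tau>)) (\<lambda>\<tau>. S \<tau> p) 0 T"
          and "V (S T p) \<le> V p - \<eta> / 2 * T * (norm p)\<^sup>2"
          using flow[OF p False] by blast
        moreover have "0 \<le> \<eta> / 2 * T * (norm p)\<^sup>2" using \<eta>_pos T_pos by simp
        ultimately show ?thesis using \<open>V p \<le> V x0\<close> by (intro exI[of _ "\<lambda>\<tau>. S \<tau> p"]) simp
      qed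
    qed simp
    then show "\<exists>\<delta>>0. \<forall>t0\<ge>0. \<forall>x0. norm x0 < \<delta> \<longrightarrow> (\<exists>x. closed_loop f ubar T t0 x \<and> x t0 = x0)"
      using \<open>\<delta> > 0\<close> by blast
  next
    fix t0 x n assume "t0 \<ge> 0" and x: "closed_loop f ubar T t0 x" and small: "norm (x (t0 + real n * T)) < r"
    let ?p = "x (t0 + real n * T)" and ?\<xi> = "\<lambda>\<tau>. x (t0 + real n * T + \<tau>)"
    have \<xi>: "pw_solution (\<lambda>\<tau>. affine_field f (ubar ?p \<tau>)) ?\<xi> 0 T"
      by (rule closed_loop_sampling_interval[OF x T_pos])
    then show "norm (?\<xi> \<tau>) \<le> \<kappa> * norm ?p" if "\<tau> \<in> {0..T}" for \<tau>
      using growth[of ?\<xi> \<tau>] small that by simp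
    then have end0: "norm (?\<xi> T) \<le> \<kappa> * norm ?p" using T_pos by simp
    have "V (?\<xi> T) \<le> V ?p - \<eta> / 2 * T * (norm ?p)\<^sup>2"
    \<comment> \<open>From the sample 0 the growth estimate forces the period to end at 0, and both
      sides agree.\<close>
    proof (cases "?p = 0")
      case True
      then have "?\<xi> T = 0" using end0 by simp
      then show ?thesis using True by simp
    next
      case False
      have "norm ?p < R" using small \<open>r \<le> R\<close> by simp
      from flow[OF this False] obtain S where "V (S T ?p) \<le> V ?p - \<eta> / 2 * T * (norm ?p)\<^sup>2"
        and uniq: "\<And>\<xi> t. pw_solution (\<lambda>\<tau>. affine_field f (ubar ?p \<tau>)) \<xi> 0 T \<Longrightarrow> t \<in> {0..T} \<Longrightarrow> \<xi> t = S t (\<xi> 0)"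
        by blast
      \<comment> \<open>Uniqueness identifies the given trajectory with the orbit of
        \<open>?p\<close> under \<open>S\<close>, for which the decrease is known.\<close>
      then show ?thesis using uniq[OF \<xi>, of T] T_pos by simp
    qed
    moreover have "t0 + real (Suc n) * T = t0 + real n * T + T" by (simp add: algebra_simps)
    ultimately show "V (x (t0 + real (Suc n) * T)) \<le> V ?p - \<eta> / 2 * T * (norm ?p)\<^sup>2"
      by (simp only:)
  qed
qed

end
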